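(* Let $\mathcal D$ be a distribution supported on some domain $\mathcal X$ and denote by $\mathcal D(x)$ the mass that it puts on $x\in\mathcal X$. For any $(\varepsilon,\delta,\rho,v)\in(0,1)^4$ such that $(v-\varepsilon,v+\varepsilon)\subseteq(0,1)$, the algorithm Replicable Heavy-Hitters (described in the context), run with threshold $v$, error $\varepsilon$, confidence $\delta$ and replicability parameter $\rho$, is $\rho$-replicable and outputs a list $L$ such that, with probability $1-\delta$, for all $x\in\mathcal X$: - if $\mathcal D(x)<v-\varepsilon$ then $x\notin L$; - if $\mathcal D(x)>v+\varepsilon$ then $x\in L$. Its sample complexity is at most $O\left(\dfrac{\log\left(1/(\min\{\delta,\rho\}(v-\varepsilon))\right)}{(v-\varepsilon)\rho^2\varepsilon^2}\right)$.
   Context: Algorithm Replicable Heavy-Hitters, with sample access to $\mathcal D$ and parameters $v,\varepsilon,\delta,\rho$: 1. Set $n_1=\frac{\log\left(2/(\min\{\delta,\rho\}(v-\varepsilon))\right)}{v-\varepsilon}$, draw a set $S_1$ of $n_1$ i.i.d. samples from $\mathcal D$, and let $\mathcal X_h$ be the set of unique elements of $S_1$ (so $|\mathcal X_h|\le n_1$). 2. Set $n_2=\frac{32\left(\ln(2/\min\{\delta,\rho\})+|\mathcal X_h|+1\right)}{\rho^2\varepsilon^2}$ and draw a set $S_2$ of $n_2$ i.i.d. samples from $\mathcal D$. 3. For every $x\in\mathcal X_h$ let $\hat p_x$ be the empirical frequency of $x$ in $S_2$. 4. Draw a threshold $v'$ uniformly at random from $[v-\varepsilon/2,v+\varepsilon/2]$.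 5. Output $L=\{x\in\mathcal X_h:\hat p_x\ge v'\}$. An algorithm using $n$ samples and internal randomness $r\sim\mathcal R$ is written $A(S,r)$, deterministic in $(S,r)$. It is $\rho$-replicable if for every distribution $\mathcal D$ over inputs, for independent $S,S'\sim\mathcal D^n$ and $r\sim\mathcal R$, $\Pr[A(S,r)\ne A(S',r)]\le\rho$. Here the internal randomness is the random threshold $v'$.
   Formalization: The O-bound fails uniformly as min{δ,ρ}(v−ε)→1; it is proved for min{δ,ρ}(v−ε)≤c, each c<1, and everywhere with max{1,log}. v=ε (division by 0) is excluded, the diagonal of the domain is assumed measurable, log in n₁ is base 2. *)

theory Defs
  imports "HOL-Probability.Probability" "HOL-Library.Landau_Symbols"
begin

text \<open>
  A sample of size \<open>n\<close> is a function on the index set \<open>{..<n}\<close>; \<open>R\<close> is the law of the internal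
  randomness. The distributions over the measurable space \<open>X\<close> are the elements of
  \<open>space (prob_algebra X)\<close>. Measurability of the disagreement event is demanded explicitly
  because \<open>measure\<close> returns 0 on non-measurable sets.
\<close>

definition replicable ::
  "real \<Rightarrow> nat \<Rightarrow> 'a measure \<Rightarrow> 'r measure \<Rightarrow> ((nat \<Rightarrow> 'a) \<Rightarrow> 'r \<Rightarrow> 'b) \<Rightarrow> bool" where
  "replicable \<rho> n X R A \<longleftrightarrow> prob_space R \<and>
     (\<forall>D \<in> space (prob_algebra X).
        let P = PiM {..<n} (\<lambda>_. D) \<Otimes>\<^sub>M (PiM {..<n} (\<lambda>_. D) \<Otimes>\<^sub>M R);
            E = {(S, S', r) \<in> space P. A S r \<noteq> A S' r}
        in E \<in> sets P \<and> measure P E \<le> \<rho>)"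

text \<open>
  The condition \<open>\<epsilon> < v\<close> excludes only the boundary case \<open>v = \<epsilon>\<close>, which the inclusion of open
  intervals permits but for which the first sample size is a division by zero.
\<close>

definition hh_params :: "real \<Rightarrow> real \<Rightarrow> real \<Rightarrow> real \<Rightarrow> bool" where
  "hh_params \<epsilon> \<delta> \<rho> v \<longleftrightarrow>
     \<epsilon> \<in> {0<..<1} \<and> \<delta> \<in> {0<..<1} \<and> \<rho> \<in> {0<..<1} \<and> v \<in> {0<..<1} \<and>
     {v - \<epsilon> <..< v + \<epsilon>} \<subseteq> {0<..<1} \<and> \<epsilon> < v"

text \<open>
  Sample sizes are rounded up. In \<open>hh_n1\<close> the logarithm is binary, whereas \<open>hh_n2\<close> uses the
  natural one. The base matters: with the natural logarithm in \<open>hh_n1\<close> two runs already disagree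
  with probability close to \<open>\<rho>\<close> because one of them misses a heavy element in its first sample,
  which leaves no room for the error caused by the threshold.
\<close>

definition hh_n1 :: "real \<Rightarrow> real \<Rightarrow> real \<Rightarrow> real \<Rightarrow> nat" where
  "hh_n1 \<epsilon> \<delta> \<rho> v = nat \<lceil>log 2 (2 / (min \<delta> \<rho> * (v - \<epsilon>))) / (v - \<epsilon>)\<rceil>"

definition hh_n2 :: "real \<Rightarrow> real \<Rightarrow> real \<Rightarrow> nat \<Rightarrow> nat" where
  "hh_n2 \<epsilon> \<delta> \<rho> k = nat \<lceil>32 * (ln (2 / min \<delta> \<rho>) + real k + 1) / (\<rho>\<^sup>2 * \<epsilon>\<^sup>2)\<rceil>"

definition emp_freq :: "(nat \<Rightarrow> 'a) \<Rightarrow> nat set \<Rightarrow> 'a \<Rightarrow> real" where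
  "emp_freq S I x = real (card {i \<in> I. S i = x}) / real (card I)"

definition hh_threshold :: "real \<Rightarrow> real \<Rightarrow> real measure" where
  "hh_threshold \<epsilon> v = uniform_measure lborel {v - \<epsilon> / 2 .. v + \<epsilon> / 2}"

text \<open>
  The second sample size depends on the first sample. To have a fixed sample size \<open>n\<close>, the
  algorithm receives the largest number of samples it can need and leaves the surplus unread.
\<close>

definition hh_sample_size :: "real \<Rightarrow> real \<Rightarrow> real \<Rightarrow> real \<Rightarrow> nat" where
  "hh_sample_size \<epsilon> \<delta> \<rho> v = hh_n1 \<epsilon> \<delta> \<rho> v + hh_n2 \<epsilon> \<delta> \<rho> (hh_n1 \<epsilon> \<delta> \<rho> v)"

definition heavy_hitters ::
  "real \<Rightarrow> real \<Rightarrow> real \<Rightarrow> real \<Rightarrow> (nat \<Rightarrow> 'a) \<Rightarrow> real \<Rightarrow> 'a set" where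
  "heavy_hitters \<epsilon> \<delta> \<rho> v S v' =
     (let n1 = hh_n1 \<epsilon> \<delta> \<rho> v;
          Xh = S ` {..<n1};
          n2 = hh_n2 \<epsilon> \<delta> \<rho> (card Xh)
      in {x \<in> Xh. emp_freq S {n1..<n1 + n2} x \<ge> v'})"

lemma hh_reads_within_sample:
  "hh_n1 \<epsilon> \<delta> \<rho> v + hh_n2 \<epsilon> \<delta> \<rho> (card (S ` {..<hh_n1 \<epsilon> \<delta> \<rho> v})) \<le> hh_sample_size \<epsilon> \<delta> \<rho> v"
proof -
  have "card (S ` {..<hh_n1 \<epsilon> \<delta> \<rho> v}) \<le> hh_n1 \<epsilon> \<delta> \<rho> v"
    using card_image_le[of "{..<hh_n1 \<epsilon> \<delta> \<rho> v}" S] by simp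
  then show ?thesis
    unfolding hh_sample_size_def hh_n2_def
    by (intro add_left_mono nat_mono ceiling_mono divide_right_mono) auto
qed

end

theory Submission
  imports Defs "HOL-Probability.Hoeffding"
begin

text \<open>
  A single run is compared with the list \<open>ideal v'\<close> of all \<open>x\<close> with \<open>\<D>(x) \<ge> v'\<close>, which depends on the
  threshold only. If a run differs from it with probability at most \<open>\<rho> / 2\<close>, then two runs sharing
  the threshold differ with probability at most \<open>\<rho>\<close>. There are three ways to differ. The first
  sample may miss one of the at most \<open>1 / (v - \<epsilon>)\<close> elements of mass at least \<open>v - \<epsilon>\<close>. Some candidate
  may have an empirical frequency off by \<open>\<epsilon> / 2\<close>, which is unlikely by Hoeffding's inequality
  conditionally on the first sample. Finally, the threshold may fall between the mass and
  the empirical frequency of a heavy element. Given the sample, this has probability at most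
  \<open>\<Sum>\<^sub>x \<bar>p\<^sub>x - \<D>(x)\<bar> / \<epsilon>\<close>, where the sum ranges over the heavy elements and \<open>p\<^sub>x\<close> is the empirical
  frequency. A union bound over these elements would be too weak, but the expected sum is small: it
  is controlled by the variances \<open>\<D>(x) / n\<^sub>2\<close>, whose total is at most \<open>1 / n\<^sub>2\<close>. Accuracy only needs the
  first two events to be excluded.
\<close>

section \<open>Empirical frequencies under a product measure\<close>

text \<open>The family of all coordinates is the identity map on the product space, so its joint law
  is the product measure itself, which is also the product of the marginals.\<close>

lemma (in prob_space) indep_vars_PiM_coordinates:
  assumes "J \<noteq> {}"
  shows "prob_space.indep_vars (PiM J (\<lambda>_. M)) (\<lambda>_. M) (\<lambda>i \<omega>. \<omega> i) J"
proof -
  interpret P: prob_space "PiM J (\<lambda>_. M)"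
    by (intro prob_space_PiM prob_space_axioms)
  have "distr (PiM J (\<lambda>_. M)) (PiM J (\<lambda>_. M)) (\<lambda>x. restrict x J) = distr (PiM J (\<lambda>_. M)) (PiM J (\<lambda>_. M)) (\<lambda>x. x)"
    by (intro distr_cong) (auto simp: space_PiM)
  also have "\<dots> = PiM J (\<lambda>_. M)" by (simp add: distr_id)
  also have "\<dots> = PiM J (\<lambda>i. distr (PiM J (\<lambda>_. M)) M (\<lambda>\<omega>. \<omega> i))"
    by (intro PiM_cong refl distr_PiM_component[symmetric] prob_space_axioms)
  finally show ?thesis
    by (subst P.indep_vars_iff_distr_eq_PiM') (use assms in \<open>auto simp: restrict_def\<close>)
qed

lemma emp_freq_eq_sum:
  "finite I \<Longrightarrow> emp_freq S I x = (\<Sum>i\<in>I. of_bool (S i = x)) / real (card I)"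
  by (simp add: emp_freq_def of_bool_def Int_def flip: sum.inter_filter)

text \<open>A measurable diagonal makes equality of two sampled points an event. Its slices also
  yield measurable singletons and a measurable map \<open>mass\<close>.\<close>

locale diagonal_prob_space = prob_space M for M :: "'a measure" +
  assumes diagonal: "{(x, y) \<in> space (M \<Otimes>\<^sub>M M). x = y} \<in> sets (M \<Otimes>\<^sub>M M)"
begin

abbreviation mass :: "'a \<Rightarrow> real" where
  "mass x \<equiv> measure M {x}"

lemma singleton_sets:
  assumes "x \<in> space M"
  shows "{x} \<in> sets M"
proof -
  have "Pair x -` {(x, y) \<in> space (M \<Otimes>\<^sub>M M). x = y} = {x}"
    using assms by (auto simp: space_pair_measure)
  with sets_Pair1[OF diagonal, of x] show ?thesis by simp
qed

text \<open>A singleton outside the space is not a measurable set, and \<open>measure\<close>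
  returns 0 on it.\<close>

lemma mass_pos_in_space: "0 < mass x \<Longrightarrow> x \<in> space M"
  by (metis insertI1 measure_notin_sets not_less_iff_gr_or_eq sets.sets_into_space subsetD)

lemma pred_eq [measurable]:
  assumes "f \<in> N \<rightarrow>\<^sub>M M" "g \<in> N \<rightarrow>\<^sub>M M"
  shows "Measurable.pred N (\<lambda>\<omega>. f \<omega> = g \<omega>)"
proof -
  have "(\<lambda>\<omega>. (f \<omega>, g \<omega>)) \<in> N \<rightarrow>\<^sub>M M \<Otimes>\<^sub>M M"
    using assms by simp
  from measurable_sets[OF this diagonal]
  have "(\<lambda>\<omega>. (f \<omega>, g \<omega>)) -` {(x, y) \<in> space (M \<Otimes>\<^sub>M M). x = y} \<inter> space N \<in> sets N" .
  also have "(\<lambda>\<omega>. (f \<omega>, g \<omega>)) -` {(x, y) \<in> space (M \<Otimes>\<^sub>M M). x = y} \<inter> space N = {\<omega> \<in> space N. f \<omega> = g \<omega>}"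
    using assms[THEN measurable_space] by (auto simp: space_pair_measure)
  finally show ?thesis by (simp add: pred_def)
qed

lemma mass_measurable [measurable]: "mass \<in> borel_measurable M"
proof -
  have "(\<lambda>x. emeasure M (Pair x -` {(x, y) \<in> space (M \<Otimes>\<^sub>M M). x = y})) \<in> borel_measurable M"
    using diagonal by (rule measurable_emeasure_Pair)
  then have "(\<lambda>x. enn2real (emeasure M (Pair x -` {(x, y) \<in> space (M \<Otimes>\<^sub>M M). x = y}))) \<in> borel_measurable M"
    by simp
  moreover have "Pair x -` {(x, y) \<in> space (M \<Otimes>\<^sub>M M). x = y} = {x}" if "x \<in> space M" for x
    using that by (auto simp: space_pair_measure)
  ultimately show ?thesis
    by (simp add: measure_def cong: measurable_cong)
qed

lemma sum_mass_le_1: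
  assumes "finite F"
  shows "sum mass F \<le> 1"
proof -
  have "sum mass F = sum mass (F \<inter> space M)"
    using assms mass_pos_in_space
    by (intro sum.mono_neutral_right) (auto simp: less_le)
  also have "\<dots> = measure M (F \<inter> space M)"
    using assms singleton_sets by (intro finite_measure_eq_sum_singleton[symmetric]) auto
  finally show ?thesis by simp
qed

text \<open>Finitely many such points have total mass at most 1, so there are at most
  \<open>1 / q\<close> of them. This uniform bound on finite subsets also forces the whole set to be
  finite.\<close>

lemma
  assumes "0 < q"
  shows finite_mass_ge: "finite {x. q \<le> mass x}"
    and card_mass_ge: "card {x. q \<le> mass x} \<le> 1 / q"
proof -
  have *: "card F \<le> 1 / q" if "finite F" "F \<subseteq> {x. q \<le> mass x}" for F
  proof -
    have "card F * q \<le> sum mass F"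
      using that by (intro sum_bounded_below) auto
    also have "\<dots> \<le> 1" using that by (intro sum_mass_le_1)
    finally show ?thesis using assms by (simp add: field_simps)
  qed
  show "finite {x. q \<le> mass x}"
    using * by (intro finite_if_finite_subsets_card_bdd[where F = "{x. q \<le> mass x}" and C = "nat \<lfloor>1 / q\<rfloor>", THEN conjunct1])
      (auto simp: le_nat_floor)
  with * show "card {x. q \<le> mass x} \<le> 1 / q" by blast
qed

section \<open>Mean, concentration and variance of empirical frequencies\<close>

lemma coordinate_expectation:
  assumes "i \<in> J" "x \<in> space M"
  shows "integral\<^sup>L (PiM J (\<lambda>_. M)) (\<lambda>S. of_bool (S i = x)) = mass x"
    (is "?l = _")
proof -
  have [measurable]: "(\<lambda>y. of_bool (y = x)::real) \<in> borel_measurable M"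
    using assms by measurable
  have "?l = (\<integral>y. of_bool (y = x) \<partial>distr (PiM J (\<lambda>_. M)) M (\<lambda>S. S i))"
    using assms by (subst integral_distr) auto
  also have "\<dots> = (\<integral>y. of_bool (y = x) \<partial>M)"
    using assms by (subst distr_PiM_component) (auto intro: prob_space_axioms)
  also have "\<dots> = (\<integral>y. indicator {x} y \<partial>M)"
    by (intro Bochner_Integration.integral_cong) (auto simp: indicator_def)
  also have "\<dots> = mass x"
    using assms by (simp add: singleton_sets Int_absorb1 sets.sets_into_space)
  finally show ?thesis .
qed

lemma coordinate_measurable:
  assumes "i \<in> J" "x \<in> space M"
  shows "(\<lambda>S. of_bool (S i = x) :: real) \<in> borel_measurable (PiM J (\<lambda>_. M))"
  using assms by measurable

lemma emp_freq_measurable: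
  assumes "finite I" "I \<subseteq> J" "x \<in> space M"
  shows "(\<lambda>S. emp_freq S I x) \<in> borel_measurable (PiM J (\<lambda>_. M))"
  unfolding emp_freq_eq_sum[OF assms(1)]
  using assms by (intro borel_measurable_divide borel_measurable_sum coordinate_measurable) auto

lemma indep_vars_coordinate_eq:
  assumes "I \<subseteq> J" "I \<noteq> {}" "x \<in> space M"
  shows "prob_space.indep_vars (PiM J (\<lambda>_. M)) (\<lambda>_. borel) (\<lambda>i S. of_bool (S i = x) :: real) I"
proof -
  interpret P: prob_space "PiM J (\<lambda>_. M)"
    by (intro prob_space_PiM prob_space_axioms)
  have "P.indep_vars (\<lambda>_. M) (\<lambda>i S. S i) I"
    using assms by (intro P.indep_vars_subset[OF indep_vars_PiM_coordinates]) auto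
  then show ?thesis
    by (rule P.indep_vars_compose2) (use assms in measurable)
qed

text \<open>Hoeffding's inequality for the number of hits, at deviation \<open>card I * t\<close>.
  The index set \<open>J\<close> may exceed \<open>I\<close> because a run leaves surplus samples
  unread.\<close>

lemma emp_freq_Hoeffding:
  assumes I: "finite I" "I \<noteq> {}" "I \<subseteq> J" and x: "x \<in> space M" and t: "0 \<le> t"
  shows "measure (PiM J (\<lambda>_. M)) {S \<in> space (PiM J (\<lambda>_. M)). t \<le> \<bar>emp_freq S I x - mass x\<bar>}
           \<le> 2 * exp (-2 * real (card I) * t\<^sup>2)"
proof -
  interpret P: prob_space "PiM J (\<lambda>_. M)"
    by (intro prob_space_PiM prob_space_axioms)
  interpret H: Hoeffding_ineq "PiM J (\<lambda>_. M)" I "\<lambda>i S. of_bool (S i = x)" "\<lambda>_. 0" "\<lambda>_. 1" "card I * mass x"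
  proof unfold_locales
    show "P.indep_vars (\<lambda>_. borel) (\<lambda>i S. of_bool (S i = x) :: real) I"
      using I x by (intro indep_vars_coordinate_eq)
    have "(\<Sum>i\<in>I. P.expectation (\<lambda>S. of_bool (S i = x))) = (\<Sum>i\<in>I. mass x)"
      using I x by (intro sum.cong refl coordinate_expectation) auto
    then show "card I * mass x \<equiv> (\<Sum>i\<in>I. P.expectation (\<lambda>S. of_bool (S i = x)))"
      by simp
  qed (use I in auto)
  have n: "0 < card I" using I by (simp add: card_gt_0_iff)
  have "(t \<le> \<bar>emp_freq S I x - mass x\<bar>) \<longleftrightarrow>
        (card I * t \<le> \<bar>(\<Sum>i\<in>I. of_bool (S i = x)) - card I * mass x\<bar>)" for S
  proof -
    have "(\<Sum>i\<in>I. of_bool (S i = x)) - card I * mass x = card I * (emp_freq S I x - mass x)"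
      using n I by (simp add: emp_freq_eq_sum field_simps)
    then show ?thesis using n by (simp add: abs_mult)
  qed
  then show ?thesis
    using H.Hoeffding_ineq_abs_ge[of "card I * t"] n t
    by (simp add: power_mult_distrib power2_eq_square mult_ac)
qed

text \<open>The variance of a mean of independent indicators is
  \<open>mass x * (1 - mass x) / card I\<close>. The bound keeps the factor \<open>mass x\<close>,
  which sums to at most 1 over the heavy elements.\<close>

lemma emp_freq_second_moment:
  assumes I: "finite I" "I \<noteq> {}" "I \<subseteq> J" and x: "x \<in> space M"
  shows "(\<integral>\<^sup>+S. ennreal ((emp_freq S I x - mass x)\<^sup>2) \<partial>PiM J (\<lambda>_. M)) \<le> ennreal (mass x / card I)"
proof -
  interpret P: prob_space "PiM J (\<lambda>_. M)"
    by (intro prob_space_PiM prob_space_axioms)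
  have n: "0 < card I" using I by (simp add: card_gt_0_iff)
  define Z where "Z i S = (of_bool (S i = x) - mass x :: real)" for i and S :: "nat \<Rightarrow> 'a"
  have Zm [measurable]: "Z i \<in> borel_measurable (PiM J (\<lambda>_. M))" if "i \<in> I" for i
    unfolding Z_def using that I x coordinate_measurable[of i J x] by auto
  have Zbd: "\<bar>Z i S\<bar> \<le> 1" for i S
    by (auto simp: Z_def)
  have Zint: "integrable (PiM J (\<lambda>_. M)) (Z i)" if "i \<in> I" for i
    using that Zbd by (intro P.integrable_const_bound[where B = 1]) auto
  have ZZint: "integrable (PiM J (\<lambda>_. M)) (\<lambda>S. Z i S * Z j S)" if "i \<in> I" "j \<in> I" for i j
  proof (rule P.integrable_const_bound[where B = 1])
    show "AE S in PiM J (\<lambda>_. M). norm (Z i S * Z j S) \<le> 1"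
      using Zbd by (auto simp: abs_mult intro!: mult_le_one)
  qed (use that in measurable)
  have indep: "P.indep_vars (\<lambda>_. borel) Z I"
    unfolding Z_def by (rule P.indep_vars_compose2[OF indep_vars_coordinate_eq[OF I(3,2) x]]) auto
  have oint: "integrable (PiM J (\<lambda>_. M)) (\<lambda>S. of_bool (S i = x) :: real)" if "i \<in> I" for i
    using that I x coordinate_measurable[of i J x]
    by (intro P.integrable_const_bound[where B = 1]) auto
  have E0: "P.expectation (Z i) = 0" if "i \<in> I" for i
    using that I x oint[OF that] by (simp add: Z_def[abs_def] coordinate_expectation subsetD P.prob_space)
  have cross: "P.expectation (\<lambda>S. Z i S * Z j S) = 0" if "i \<in> I" "j \<in> I" "i \<noteq> j" for i j
    using P.indep_vars_lebesgue_integral[OF _ P.indep_vars_subset[OF indep], of "{i, j}"] that E0 Zint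
    by auto
  have diag: "P.expectation (\<lambda>S. Z i S * Z i S) \<le> mass x" if "i \<in> I" for i
  proof -
    \<comment> \<open>An indicator equals its square, so the square of \<open>Z i S\<close> is
      affine in the indicator.\<close>
    have "Z i S * Z i S = (1 - 2 * mass x) * of_bool (S i = x) + (mass x)\<^sup>2" for S
      by (auto simp: Z_def power2_eq_square algebra_simps)
    then have "P.expectation (\<lambda>S. Z i S * Z i S) = (1 - 2 * mass x) * mass x + (mass x)\<^sup>2"
      using oint[OF that] that I x by (simp add: coordinate_expectation subsetD P.prob_space)
    also have "\<dots> \<le> mass x"
      by (simp add: power2_eq_square algebra_simps)
    finally show ?thesis .
  qed
  have eq: "(emp_freq S I x - mass x)\<^sup>2 = (\<Sum>i\<in>I. \<Sum>j\<in>I. Z i S * Z j S) / (card I)\<^sup>2" for S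
  proof -
    have "emp_freq S I x - mass x = (\<Sum>i\<in>I. Z i S) / card I"
      using I n by (simp add: emp_freq_eq_sum Z_def sum_subtractf field_simps)
    then show ?thesis
      by (simp add: power2_eq_square sum_product)
  qed
  have "P.expectation (\<lambda>S. (emp_freq S I x - mass x)\<^sup>2)
      = (\<Sum>i\<in>I. \<Sum>j\<in>I. P.expectation (\<lambda>S. Z i S * Z j S)) / (card I)\<^sup>2"
    unfolding eq using ZZint by (simp add: Bochner_Integration.integral_sum)
  \<comment> \<open>Only the diagonal terms survive, since distinct coordinates are independent and
    centred.\<close>
  also have "(\<Sum>i\<in>I. \<Sum>j\<in>I. P.expectation (\<lambda>S. Z i S * Z j S)) = (\<Sum>i\<in>I. P.expectation (\<lambda>S. Z i S * Z i S))"
    using I cross by (intro sum.cong refl) (auto simp: sum.remove intro!: sum.neutral)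
  also have "\<dots> \<le> (\<Sum>i\<in>I. mass x)" by (intro sum_mono diag)
  also have "(\<Sum>i\<in>I. mass x) / (card I)\<^sup>2 = mass x / card I"
    using n by (simp add: power2_eq_square)
  finally have le: "P.expectation (\<lambda>S. (emp_freq S I x - mass x)\<^sup>2) \<le> mass x / card I"
    by (simp add: divide_right_mono)
  have "integrable (PiM J (\<lambda>_. M)) (\<lambda>S. (emp_freq S I x - mass x)\<^sup>2)"
    unfolding eq using ZZint by auto
  then show ?thesis
    using le by (subst nn_integral_eq_integral) (auto intro: ennreal_leI)
qed

end

section \<open>Numerical estimates\<close>

text \<open>The left side is a union bound over at most \<open>1 / q\<close> elements of mass at
  least \<open>q\<close>, each missed by \<open>n\<close> draws. A natural logarithm would give
  \<open>m / 2\<close>; the binary one improves the factor to 7/25 and leaves room for the other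
  errors.\<close>

lemma miss_probability_numeric:
  fixes q m :: real
  assumes q: "0 < q" "q \<le> 1" and m: "0 < m" "m \<le> 1"
    and n: "log 2 (2 / (m * q)) / q \<le> real n"
  shows "(1 / q) * (1 - q) ^ n \<le> 7 / 25 * m"
proof -
  define L where "L = log 2 (2 / (m * q))"
  define y where "y = m * q / 2"
  have y: "0 < y" using q m by (simp add: y_def)
  have L: "L = - ln y / ln 2"
    using q m by (simp add: L_def y_def log_def ln_div)
  have qn: "L \<le> q * n"
    using n q by (simp add: L_def field_simps)
  txt \<open>For \<open>q\<close> close to 1 the bound \<open>1 - q \<le> exp (- q)\<close> loses too much; there \<open>1 - q \<le> 4 powr (- q)\<close> replaces it.\<close>
  show ?thesis
  proof (cases "q \<le> 1 / 2")
    case True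
    have y4: "y \<le> 1 / 4"
      unfolding y_def using mult_mono[of m 1 q "1/2"] True q m by simp
    have lny: "ln y \<le> - 2 * ln 2"
    proof -
      have "ln y \<le> ln (1 / 4)" using y y4 by (subst ln_le_cancel_iff) auto
      also have "\<dots> = - ln (2 ^ 2)" by (simp add: ln_div)
      also have "\<dots> = - 2 * ln 2" by (subst ln_realpow) auto
      finally show ?thesis .
    qed
    \<comment> \<open>This is the gain from base 2. As \<open>q\<close> is at most 1/2,
      \<open>- ln y / ln 2\<close> is at least 2, and \<open>1 - ln 2\<close> is at least
      11/36.\<close>
    have "L - (- ln y) = (- ln y / ln 2) * (1 - ln 2)"
      by (simp add: L field_simps)
    also have "\<dots> \<ge> 2 * (11 / 36)"
    proof (rule mult_mono)
      show "2 \<le> - ln y / ln 2" using lny by (simp add: field_simps)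
      have "0 < ln (2::real)" by simp
      then show "0 \<le> - ln y / ln 2" using lny by (intro divide_nonneg_pos) linarith+
    qed (use ln2_le_25_over_36 in auto)
    finally have Ly: "11 / 18 - ln y \<le> L" by simp
    \<comment> \<open>The target 14/25 is twice 7/25; the remaining factor 1/2 comes from
      \<open>y = m * q / 2\<close>.\<close>
    have "(25 / 14 :: real) \<le> exp (11 / 18)"
      using exp_lower_Taylor_quadratic[of "11/18"] by (simp add: power2_eq_square)
    then have e: "exp (- (11 / 18)) \<le> (14 / 25 :: real)"
      by (simp add: exp_minus field_simps)
    have "(1 - q) ^ n \<le> exp (- q) ^ n"
      using q exp_ge_add_one_self[of "- q"] by (intro power_mono) auto
    also have "\<dots> = exp (- (q * n))"
      by (simp add: exp_of_nat_mult[symmetric] mult.commute)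
    also have "\<dots> \<le> exp (ln y + (- (11 / 18)))"
      using qn Ly by simp
    also have "\<dots> = y * exp (- (11 / 18))"
      using y by (subst exp_add) simp
    also have "\<dots> \<le> y * (14 / 25)"
      using y e by (intro mult_left_mono) auto
    finally show ?thesis
      using q by (simp add: y_def field_simps)
  next
    case False
    have L4: "- 2 * ln 2 * L = 2 * ln y" by (simp add: L)
    \<comment> \<open>The function \<open>exp (- (2 * ln 2 * q))\<close> equals 1/2 at
      \<open>q = 1 / 2\<close>. Its tangent there has slope \<open>- ln 2\<close>, which is greater
      than -1, so it stays above \<open>1 - q\<close> to the right.\<close>
    have "exp (- (2 * ln 2 * q)) = exp (- (2 * ln 2 * (q - 1 / 2))) * exp (- ln 2)"
      by (simp add: exp_add[symmetric] algebra_simps)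
    also have "\<dots> = exp (- (2 * ln 2 * (q - 1 / 2))) / 2"
      by (simp add: exp_minus)
    also have "\<dots> \<ge> (1 - (2 * ln 2 * (q - 1 / 2))) / 2"
      using exp_ge_add_one_self[of "- (2 * ln 2 * (q - 1 / 2))"] by simp
    finally have "(1 - (2 * ln 2 * (q - 1 / 2))) / 2 \<le> exp (- (2 * ln 2 * q))" .
    moreover have "ln 2 * (q - 1 / 2) \<le> 1 * (q - 1 / 2)"
      using False ln_2_less_1 by (intro mult_right_mono) auto
    ultimately have "1 - q \<le> exp (- (2 * ln 2 * q))"
      by (simp add: field_simps)
    then have "(1 - q) ^ n \<le> exp (- (2 * ln 2 * q)) ^ n"
      using q by (intro power_mono) auto
    also have "\<dots> = exp (- (2 * ln 2 * (q * n)))"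
      by (simp add: exp_of_nat_mult[symmetric] mult_ac)
    also have "\<dots> \<le> exp (- 2 * ln 2 * L)"
      using qn by simp
    also have "\<dots> = y\<^sup>2"
      using y unfolding L4 by (simp add: exp_double)
    finally have "(1 / q) * (1 - q) ^ n \<le> (1 / q) * y\<^sup>2"
      using q by (intro mult_left_mono) auto
    also have "\<dots> = m * (m * q) / 4"
      using q by (simp add: y_def power2_eq_square)
    also have "\<dots> \<le> m * 1 / 4"
      using mult_mono[of m 1 q 1] q m by (intro divide_right_mono mult_left_mono) auto
    finally show ?thesis using m by simp
  qed
qed

text \<open>Union bound over \<open>k\<close> candidates of Hoeffding's inequality at deviation
  \<open>\<epsilon> / 2\<close>. The term \<open>ln (2 / m)\<close> in the sample size produces the
  factor \<open>m\<close> and cancels the 2, while the term linear in \<open>k\<close> makes the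
  exponential absorb the number of candidates.\<close>

lemma deviation_probability_numeric:
  fixes \<epsilon> \<rho> m :: real and k n :: nat
  assumes "0 < \<epsilon>" "0 < \<rho>" "\<rho> \<le> 1" "0 < m" "m \<le> 1"
    and n: "32 * (ln (2 / m) + k + 1) / (\<rho>\<^sup>2 * \<epsilon>\<^sup>2) \<le> real n"
  shows "k * (2 * exp (-2 * real n * (\<epsilon> / 2)\<^sup>2)) \<le> m / 40"
proof -
  have ln0: "0 \<le> ln (2 / m)" using assms by simp
  have "16 * (ln (2 / m) + k + 1) * \<rho>\<^sup>2 \<le> 16 * (ln (2 / m) + k + 1) * 1"
    using assms ln0 by (intro mult_left_mono power_le_one) auto
  also have "\<dots> \<le> real n * \<epsilon>\<^sup>2 / 2 * \<rho>\<^sup>2"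
    using n assms by (simp add: field_simps)
  finally have "16 * (ln (2 / m) + k + 1) \<le> real n * \<epsilon>\<^sup>2 / 2"
    using assms by simp
  also have "\<dots> = 2 * real n * (\<epsilon> / 2)\<^sup>2"
    by (simp add: power2_eq_square)
  finally have le: "ln (2 / m) + 16 * (real k + 1) \<le> 2 * real n * (\<epsilon> / 2)\<^sup>2"
    using ln0 by simp
  \<comment> \<open>Splitting the exponent \<open>16 * (k + 1)\<close> into two halves turns the
    linear lower bound on \<open>exp\<close> into a quadratic one, which beats
    \<open>40 * k\<close>.\<close>
  have "40 * real k \<le> 64 * (real k * real k) + 128 * real k + 64"
    using zero_le_square[of "real k"] by linarith
  also have "\<dots> = (8 * (real k + 1))\<^sup>2" by (simp add: power2_eq_square algebra_simps)
  also have "\<dots> \<le> (exp (8 * (real k + 1)))\<^sup>2"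
    using exp_ge_add_one_self[of "8 * (real k + 1)"] by (intro power_mono) auto
  also have "\<dots> = exp (16 * (real k + 1))"
    by (simp add: exp_double[symmetric])
  finally have "40 * real k \<le> exp (16 * (real k + 1))" .
  then have "real k / exp (16 * (real k + 1)) \<le> 1 / 40"
    by (subst pos_divide_le_eq) simp_all
  then have ek: "real k * exp (- (16 * (real k + 1))) \<le> 1 / 40"
    by (simp only: exp_minus divide_inverse)
  have "k * (2 * exp (-2 * real n * (\<epsilon> / 2)\<^sup>2)) \<le> k * (2 * exp (- ln (2 / m) + - (16 * (real k + 1))))"
    using le by (intro mult_left_mono) auto
  also have "\<dots> = m * (real k * exp (- (16 * (real k + 1))))"
    using assms by (simp add: exp_add[symmetric] exp_minus exp_diff)
  also have "\<dots> \<le> m * (1 / 40)"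
    using ek assms by (intro mult_left_mono) auto
  finally show ?thesis by simp
qed

section \<open>A single run of the algorithm\<close>

locale heavy_hitters_run = diagonal_prob_space M for M :: "'a measure" +
  fixes \<epsilon> \<delta> \<rho> v :: real
  assumes params: "hh_params \<epsilon> \<delta> \<rho> v"
begin

abbreviation "m \<equiv> min \<delta> \<rho>"
abbreviation "n1 \<equiv> hh_n1 \<epsilon> \<delta> \<rho> v"
abbreviation "n2 \<equiv> hh_n2 \<epsilon> \<delta> \<rho>"
abbreviation "N \<equiv> hh_sample_size \<epsilon> \<delta> \<rho> v"
abbreviation "SM \<equiv> PiM {..<N} (\<lambda>_. M)"
abbreviation "R \<equiv> hh_threshold \<epsilon> v"
abbreviation "L \<equiv> heavy_hitters \<epsilon> \<delta> \<rho> v"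

definition num_candidates :: "(nat \<Rightarrow> 'a) \<Rightarrow> nat" where
  "num_candidates S = card (S ` {..<n1})"

definition freq :: "(nat \<Rightarrow> 'a) \<Rightarrow> 'a \<Rightarrow> real" where
  "freq S x = emp_freq S {n1..<n1 + n2 (num_candidates S)} x"

definition heavy :: "'a set" where
  "heavy = {x. v - \<epsilon> \<le> mass x}"

text \<open>The restriction to \<open>heavy\<close> keeps the set finite for every real
  \<open>r\<close>, as the measurability proofs require. For \<open>r\<close> in the threshold range
  it is the set of all points of mass at least \<open>r\<close>.\<close>

definition ideal :: "real \<Rightarrow> 'a set" where
  "ideal r = {x \<in> heavy. r \<le> mass x}"

definition missed :: "(nat \<Rightarrow> 'a) \<Rightarrow> bool" where
  "missed S \<longleftrightarrow> (\<exists>x\<in>heavy. x \<notin> S ` {..<n1})"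

text \<open>Candidates are addressed by their positions in the first sample. This gives a finite
  disjunction of events although the candidate set is random.\<close>

definition deviates :: "(nat \<Rightarrow> 'a) \<Rightarrow> bool" where
  "deviates S \<longleftrightarrow> (\<exists>i<n1. \<epsilon> / 2 \<le> \<bar>freq S (S i) - mass (S i)\<bar>)"

lemma
  shows eps: "0 < \<epsilon>" "\<epsilon> < 1" and rho: "0 < \<rho>" "\<rho> < 1" and del: "0 < \<delta>" "\<delta> < 1"
    and q: "0 < v - \<epsilon>" "v - \<epsilon> < 1" and m: "0 < m" "m < 1"
  using params by (auto simp: hh_params_def)

lemma n1_ge: "log 2 (2 / (m * (v - \<epsilon>))) / (v - \<epsilon>) \<le> real n1"
  unfolding hh_n1_def by (rule real_nat_ceiling_ge)

lemma n2_ge: "32 * (ln (2 / m) + real k + 1) / (\<rho>\<^sup>2 * \<epsilon>\<^sup>2) \<le> real (n2 k)"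
  unfolding hh_n2_def by (rule real_nat_ceiling_ge)

lemma n1_pos: "0 < n1"
proof -
  have "m * (v - \<epsilon>) < 1 * 1"
    using m q by (intro mult_strict_mono) auto
  then have "0 < log 2 (2 / (m * (v - \<epsilon>))) / (v - \<epsilon>)"
    using m q by (intro divide_pos_pos) (simp_all add: field_simps)
  with n1_ge show ?thesis by linarith
qed

lemma n2_pos: "0 < n2 k"
proof -
  have "0 \<le> ln (2 / m)" using m by simp
  then have "0 < 32 * (ln (2 / m) + real k + 1) / (\<rho>\<^sup>2 * \<epsilon>\<^sup>2)"
    using rho eps by (intro divide_pos_pos) auto
  with n2_ge[of k] show ?thesis by linarith
qed

lemma num_candidates_pos: "0 < num_candidates S"
  using n1_pos by (auto simp: num_candidates_def card_gt_0_iff)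

lemma reads_within: "n1 + n2 (num_candidates S) \<le> N"
  unfolding num_candidates_def by (rule hh_reads_within_sample)

lemma n1_le: "n1 \<le> N"
  using reads_within[of undefined] by simp

lemma in_L_iff: "x \<in> L S r \<longleftrightarrow> x \<in> S ` {..<n1} \<and> r \<le> freq S x"
  by (simp add: heavy_hitters_def freq_def num_candidates_def Let_def)

lemma finite_heavy: "finite heavy" and card_heavy: "card heavy \<le> 1 / (v - \<epsilon>)"
  unfolding heavy_def using q by (auto intro: finite_mass_ge card_mass_ge)

lemma heavy_in_space: "x \<in> heavy \<Longrightarrow> x \<in> space M"
  using q by (intro mass_pos_in_space) (auto simp: heavy_def)

section \<open>Measurability of the candidate count, the frequencies and the bad events\<close>

lemma measurable_num_candidates [measurable]: "num_candidates \<in> SM \<rightarrow>\<^sub>M count_space UNIV"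
proof -
  \<comment> \<open>Distinct values are counted by the positions of their first occurrence, which
    gives a finite sum of indicators of equality events.\<close>
  have eq: "num_candidates S = (\<Sum>i<n1. if \<forall>j<i. S j \<noteq> S i then 1 else 0)" for S :: "nat \<Rightarrow> 'a"
  proof -
    have "S ` {..<n1} = S ` {i. i < n1 \<and> (\<forall>j<i. S j \<noteq> S i)}"
    proof safe
      fix i assume "i < n1"
      define j where "j = (LEAST j. S j = S i)"
      have "S l \<noteq> S i" if "l < j" for l
        using that not_less_Least[of l "\<lambda>j. S j = S i"] by (simp add: j_def)
      moreover have "S j = S i" "j \<le> i"
        using LeastI[of "\<lambda>j. S j = S i" i] Least_le[of "\<lambda>j. S j = S i" i] by (auto simp: j_def)
      ultimately show "S i \<in> S ` {i. i < n1 \<and> (\<forall>j<i. S j \<noteq> S i)}"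
        using \<open>i < n1\<close> by (intro image_eqI[of _ _ j]) auto
    qed auto
    moreover have "inj_on S {i. i < n1 \<and> (\<forall>j<i. S j \<noteq> S i)}"
      by (rule inj_onI) (metis (mono_tags, lifting) linorder_neqE_nat mem_Collect_eq)
    ultimately have "num_candidates S = card {i. i < n1 \<and> (\<forall>j<i. S j \<noteq> S i)}"
      by (simp add: num_candidates_def card_image)
    also have "{i. i < n1 \<and> (\<forall>j<i. S j \<noteq> S i)} = {i\<in>{..<n1}. \<forall>j<i. S j \<noteq> S i}"
      by auto
    also have "card \<dots> = (\<Sum>i<n1. if \<forall>j<i. S j \<noteq> S i then 1 else 0)"
      by (simp add: sum.If_cases Int_def)
    finally show ?thesis .
  qed
  have [measurable]: "(\<lambda>S. S i) \<in> SM \<rightarrow>\<^sub>M M" if "i < n1" for i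
    using that n1_le by (intro measurable_component_singleton) auto
  have "Measurable.pred SM (\<lambda>S. \<forall>j\<in>{..<i}. S j \<noteq> S i)" if "i < n1" for i
    using that by (intro pred_intros_finite) auto
  then have [measurable]: "Measurable.pred SM (\<lambda>S. \<forall>j<i. S j \<noteq> S i)" if "i < n1" for i
    using that by (simp add: Ball_def)
  show ?thesis
    unfolding eq[abs_def] by (intro measurable_sum_nat) measurable
qed

text \<open>The range of the second sample depends on \<open>S\<close>. Summing over the fixed range
  up to \<open>N\<close> and moving the random cutoff into the summand makes measurability termwise.
  Letting \<open>f\<close> choose the element covers both sampled and fixed points.\<close>

lemma measurable_freq:
  assumes f [measurable]: "f \<in> SM \<rightarrow>\<^sub>M M"
  shows "(\<lambda>S. freq S (f S)) \<in> borel_measurable SM"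
proof -
  have eq: "freq S x = (\<Sum>i\<in>{n1..<N}. if S i = x \<and> i < n1 + n2 (num_candidates S) then 1 else 0) / real (n2 (num_candidates S))"
    for S x
  proof -
    have "{i \<in> {n1..<n1 + n2 (num_candidates S)}. S i = x} = {i \<in> {n1..<N}. S i = x \<and> i < n1 + n2 (num_candidates S)}"
      using reads_within[of S] by auto
    then show ?thesis
      by (simp add: freq_def emp_freq_def sum.If_cases Int_def)
  qed
  have [measurable]: "(\<lambda>S. S i) \<in> SM \<rightarrow>\<^sub>M M" if "i \<in> {n1..<N}" for i
    using that by (intro measurable_component_singleton) auto
  have [measurable]: "Measurable.pred SM (\<lambda>S. S i = f S \<and> i < n1 + n2 (num_candidates S))" if "i \<in> {n1..<N}" for i
    using that by measurable
  show ?thesis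
    unfolding eq by measurable
qed

lemma measurable_freq_coordinate [measurable]:
  "i < n1 \<Longrightarrow> (\<lambda>S. freq S (S i)) \<in> borel_measurable SM"
  using n1_le by (intro measurable_freq measurable_component_singleton) auto

lemma measurable_freq_const [measurable]:
  "x \<in> heavy \<Longrightarrow> (\<lambda>S. freq S x) \<in> borel_measurable SM"
  using heavy_in_space by (intro measurable_freq) auto

lemma pred_missed [measurable]: "Measurable.pred SM missed"
proof -
  have [measurable]: "(\<lambda>S. S i) \<in> SM \<rightarrow>\<^sub>M M" if "i < n1" for i
    using that n1_le by (intro measurable_component_singleton) auto
  have "Measurable.pred SM (\<lambda>S. \<exists>x\<in>heavy. \<forall>i\<in>{..<n1}. x \<noteq> S i)"
    using finite_heavy heavy_in_space by (intro pred_intros_finite pred_intros_logic pred_eq) auto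
  also have "(\<lambda>S. \<exists>x\<in>heavy. \<forall>i\<in>{..<n1}. x \<noteq> S i) = missed"
    by (auto simp: missed_def fun_eq_iff image_iff)
  finally show ?thesis .
qed

lemma pred_deviates [measurable]: "Measurable.pred SM deviates"
proof -
  have [measurable]: "(\<lambda>S. S i) \<in> SM \<rightarrow>\<^sub>M M" if "i < n1" for i
    using that n1_le by (intro measurable_component_singleton) auto
  have [measurable]: "(\<lambda>S. mass (S i)) \<in> borel_measurable SM" if "i < n1" for i
    using that by measurable
  have "Measurable.pred SM (\<lambda>S. \<exists>i\<in>{..<n1}. \<epsilon> / 2 \<le> \<bar>freq S (S i) - mass (S i)\<bar>)"
    by (intro pred_intros_finite) auto
  also have "(\<lambda>S. \<exists>i\<in>{..<n1}. \<epsilon> / 2 \<le> \<bar>freq S (S i) - mass (S i)\<bar>) = deviates"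
    by (auto simp: deviates_def fun_eq_iff)
  finally show ?thesis .
qed

section \<open>Probability of missing a heavy element\<close>

lemma prob_space_SM: "prob_space SM"
  by (intro prob_space_PiM prob_space_axioms)

text \<open>By independence, a fixed heavy element avoids all \<open>n1\<close> draws with
  probability \<open>(1 - mass x) ^ n1\<close>. A union bound over \<open>heavy\<close> reduces the
  claim to the numerical estimate.\<close>

lemma missed_bound: "emeasure SM {S \<in> space SM. missed S} \<le> ennreal (7 / 25 * m)"
proof -
  interpret P: product_prob_space "\<lambda>_. M" "{..<N}" ..
  have single: "measure SM {S \<in> space SM. \<forall>i\<in>{..<n1}. S i \<in> space M - {x}} \<le> (1 - (v - \<epsilon>)) ^ n1"
    if "x \<in> heavy" for x
  proof -
    have "emeasure SM {S \<in> space SM. \<forall>i\<in>{..<n1}. S i \<in> space M - {x}} = (\<Prod>i<n1. emeasure M (space M - {x}))"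
      using that n1_le heavy_in_space singleton_sets by (intro P.emeasure_PiM_Collect) auto
    also have "\<dots> = ennreal ((1 - mass x) ^ n1)"
      using that heavy_in_space[of x]
      by (simp add: emeasure_eq_measure prob_compl singleton_sets ennreal_power)
    finally have "measure SM {S \<in> space SM. \<forall>i\<in>{..<n1}. S i \<in> space M - {x}} = (1 - mass x) ^ n1"
      by (simp add: P.emeasure_eq_measure)
    also have "\<dots> \<le> (1 - (v - \<epsilon>)) ^ n1"
      using that by (intro power_mono) (auto simp: heavy_def)
    finally show ?thesis .
  qed
  have eq: "{S \<in> space SM. missed S} = (\<Union>x\<in>heavy. {S \<in> space SM. \<forall>i\<in>{..<n1}. S i \<in> space M - {x}})"
  proof -
    have "missed S \<longleftrightarrow> (\<exists>x\<in>heavy. \<forall>i\<in>{..<n1}. S i \<in> space M - {x})" if "S \<in> space SM" for S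
    proof -
      have "S i \<in> space M" if "i < n1" for i
        using \<open>S \<in> space SM\<close> that n1_le by (intro PiE_mem[of S "{..<N}"]) (auto simp: space_PiM)
      then show ?thesis by (auto simp: missed_def image_iff) metis+
    qed
    then show ?thesis by auto
  qed
  have "measure SM {S \<in> space SM. missed S} = measure SM (\<Union>x\<in>heavy. {S \<in> space SM. \<forall>i\<in>{..<n1}. S i \<in> space M - {x}})"
    by (simp only: eq)
  also have "measure SM (\<Union>x\<in>heavy. {S \<in> space SM. \<forall>i\<in>{..<n1}. S i \<in> space M - {x}})
      \<le> (\<Sum>x\<in>heavy. measure SM {S \<in> space SM. \<forall>i\<in>{..<n1}. S i \<in> space M - {x}})"
  proof (intro P.finite_measure_subadditive_finite finite_heavy image_subsetI)
    fix x assume x: "x \<in> heavy"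
    have A: "space M - {x} \<in> sets M"
      using x heavy_in_space singleton_sets by auto
    have "(\<lambda>S. S i) \<in> SM \<rightarrow>\<^sub>M M" if "i \<in> {..<n1}" for i
      using that n1_le by (intro measurable_component_singleton) auto
    from pred_sets2[OF A this] have "Measurable.pred SM (\<lambda>S. S i \<in> space M - {x})" if "i \<in> {..<n1}" for i
      using that by blast
    then have "Measurable.pred SM (\<lambda>S. \<forall>i\<in>{..<n1}. S i \<in> space M - {x})"
      by (intro pred_intros_finite) auto
    then show "{S \<in> space SM. \<forall>i\<in>{..<n1}. S i \<in> space M - {x}} \<in> sets SM"
      by (simp add: pred_def)
  qed
  also have "\<dots> \<le> card heavy * (1 - (v - \<epsilon>)) ^ n1"
    using single by (intro sum_bounded_above)
  also have "\<dots> \<le> (1 / (v - \<epsilon>)) * (1 - (v - \<epsilon>)) ^ n1"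
    using q by (intro mult_right_mono card_heavy) auto
  also have "\<dots> \<le> 7 / 25 * m"
    using q m n1_ge by (intro miss_probability_numeric) auto
  finally have "measure SM {S \<in> space SM. missed S} \<le> 7 / 25 * m" .
  then show ?thesis by (simp add: P.emeasure_eq_measure ennreal_leI)
qed

section \<open>Conditioning on the first sample\<close>

abbreviation "SM1 \<equiv> PiM {..<n1} (\<lambda>_. M)"
abbreviation "SM2 \<equiv> PiM {n1..<N} (\<lambda>_. M)"
abbreviation "glue T U \<equiv> merge {..<n1} {n1..<N} (T, U)"

text \<open>Fubini for the two blocks of samples. With the first block fixed, the candidates and the
  second sample size are constants, so the estimates for a deterministic index set apply.\<close>

lemma nn_integral_split_sample:
  assumes f: "f \<in> borel_measurable SM"
    and le: "\<And>T. T \<in> space SM1 \<Longrightarrow> (\<integral>\<^sup>+U. f (glue T U) \<partial>SM2) \<le> c"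
  shows "(\<integral>\<^sup>+S. f S \<partial>SM) \<le> c"
proof -
  interpret P: product_sigma_finite "\<lambda>_. M" ..
  interpret P1: prob_space SM1
    by (intro prob_space_PiM prob_space_axioms)
  have un: "{..<n1} \<union> {n1..<N} = {..<N}" using n1_le by auto
  have dis: "{..<n1} \<inter> {n1..<N} = {}" by auto
  have "(\<integral>\<^sup>+S. f S \<partial>SM) = (\<integral>\<^sup>+T. (\<integral>\<^sup>+U. f (glue T U) \<partial>SM2) \<partial>SM1)"
    using P.product_nn_integral_fold[OF dis, of f] f unfolding un by auto
  also have "\<dots> \<le> (\<integral>\<^sup>+T. c \<partial>SM1)"
    by (intro nn_integral_mono le)
  also have "\<dots> = c" by (simp add: P1.emeasure_space_1)
  finally show ?thesis .
qed

lemma glue_image: "glue T U ` {..<n1} = T ` {..<n1}"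
  by (intro image_cong) (auto simp: merge_def)

lemma num_candidates_glue: "num_candidates (glue T U) = num_candidates T"
  by (simp add: num_candidates_def glue_image)

lemma missed_glue: "missed (glue T U) = missed T"
  by (simp add: missed_def glue_image)

lemma freq_glue: "freq (glue T U) x = emp_freq U {n1..<n1 + n2 (num_candidates T)} x"
proof -
  have "{i \<in> {n1..<n1 + n2 (num_candidates T)}. glue T U i = x} = {i \<in> {n1..<n1 + n2 (num_candidates T)}. U i = x}"
    using reads_within[of T] by (auto simp: merge_def)
  then show ?thesis by (simp add: freq_def emp_freq_def num_candidates_glue)
qed

lemma second_range:
  "{n1..<n1 + n2 (num_candidates T)} \<subseteq> {n1..<N}" "{n1..<n1 + n2 (num_candidates T)} \<noteq> {}"
  using reads_within[of T] n2_pos by auto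

text \<open>Given the first block, a union bound over its distinct values uses Hoeffding's
  inequality on the second block. The resulting bound does not depend on the first block, because
  the second sample size grows with the number of candidates.\<close>

lemma deviates_bound: "emeasure SM {S \<in> space SM. deviates S} \<le> ennreal (m / 40)"
proof -
  have "emeasure SM {S \<in> space SM. deviates S}
      = (\<integral>\<^sup>+S. indicator {S \<in> space SM. deviates S} S \<partial>SM)"
    by (subst nn_integral_indicator) auto
  also have "\<dots> \<le> ennreal (m / 40)"
  proof (rule nn_integral_split_sample)
    fix T assume T: "T \<in> space SM1"
    let ?I = "{n1..<n1 + n2 (num_candidates T)}" and ?A = "T ` {..<n1}"
    define B where "B x = {U \<in> space SM2. \<epsilon> / 2 \<le> \<bar>emp_freq U ?I x - mass x\<bar>}" for x
    interpret P2: prob_space SM2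
      by (intro prob_space_PiM prob_space_axioms)
    have A: "x \<in> space M" if "x \<in> ?A" for x
      using T that by (auto simp: space_PiM PiE_iff)
    have Bm [measurable]: "B x \<in> sets SM2" if "x \<in> ?A" for x
    proof -
      have [measurable]: "(\<lambda>S. emp_freq S ?I x) \<in> borel_measurable SM2"
        using A[OF that] second_range by (intro emp_freq_measurable) auto
      show ?thesis unfolding B_def by measurable
    qed
    have "(\<integral>\<^sup>+U. indicator {S \<in> space SM. deviates S} (glue T U) \<partial>SM2)
        \<le> (\<integral>\<^sup>+U. (\<Sum>x\<in>?A. indicator (B x) U) \<partial>SM2)"
    proof (rule nn_integral_mono)
      fix U assume U: "U \<in> space SM2"
      show "indicator {S \<in> space SM. deviates S} (glue T U) \<le> (\<Sum>x\<in>?A. indicator (B x) U :: ennreal)"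
      proof (cases "deviates (glue T U)")
        case True
        then obtain i where i: "i < n1" "\<epsilon> / 2 \<le> \<bar>freq (glue T U) (glue T U i) - mass (glue T U i)\<bar>"
          by (auto simp: deviates_def)
        moreover have "glue T U i = T i" using i by (simp add: merge_def)
        ultimately have "U \<in> B (T i)" using U by (simp add: B_def freq_glue)
        then have "1 \<le> (indicator (B (T i)) U :: ennreal)" by simp
        also have "\<dots> \<le> (\<Sum>x\<in>?A. indicator (B x) U :: ennreal)"
          using i by (intro member_le_sum) auto
        finally show ?thesis by (auto simp: indicator_def)
      qed simp
    qed
    also have "\<dots> = (\<Sum>x\<in>?A. emeasure SM2 (B x))"
      by (subst nn_integral_sum) auto
    also have "\<dots> \<le> (\<Sum>x\<in>?A. ennreal (2 * exp (-2 * real (card ?I) * (\<epsilon> / 2)\<^sup>2)))"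
      unfolding P2.emeasure_eq_measure B_def
      using A second_range eps by (intro sum_mono ennreal_leI emp_freq_Hoeffding) auto
    also have "\<dots> = ennreal (num_candidates T * (2 * exp (-2 * real (n2 (num_candidates T)) * (\<epsilon> / 2)\<^sup>2)))"
      by (simp add: num_candidates_def ennreal_mult flip: ennreal_of_nat_eq_real_of_nat)
    also have "\<dots> \<le> ennreal (m / 40)"
      using eps rho m n2_ge by (intro ennreal_leI deviation_probability_numeric[where \<rho> = \<rho>]) auto
    finally show "(\<integral>\<^sup>+U. indicator {S \<in> space SM. deviates S} (glue T U) \<partial>SM2) \<le> ennreal (m / 40)" .
  qed measurable
  finally show ?thesis .
qed

text \<open>
  Bounds the probability that the threshold separates the mass of a heavy element from its empirical
  frequency. It is set to 0 on samples with a missed element because only on the other ones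
  the number of candidates, and hence the second sample size, dominates the number of heavy elements.
\<close>

definition flip_mass :: "(nat \<Rightarrow> 'a) \<Rightarrow> real" where
  "flip_mass S = (if missed S then 0 else (\<Sum>x\<in>heavy. \<bar>freq S x - mass x\<bar> / \<epsilon>))"

lemma flip_mass_measurable [measurable]: "flip_mass \<in> borel_measurable SM"
proof -
  have "(\<lambda>S. \<Sum>x\<in>heavy. \<bar>freq S x - mass x\<bar> / \<epsilon>) \<in> borel_measurable SM"
    by (intro borel_measurable_sum) measurable
  then show ?thesis unfolding flip_mass_def[abs_def] by measurable
qed

text \<open>Each absolute deviation is bounded by a weighted square plus a constant. The squares
  contribute at most \<open>3 / 32 * \<rho>\<close>, as the variances are proportional to masses
  with sum at most 1. The constants contribute at most \<open>\<rho> / 12\<close>, as there are at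
  most \<open>k\<close> heavy elements.\<close>

lemma flip_mass_bound: "(\<integral>\<^sup>+S. ennreal (flip_mass S) \<partial>SM) \<le> ennreal (17 / 96 * \<rho>)"
proof (rule nn_integral_split_sample)
  fix T assume T: "T \<in> space SM1"
  show "(\<integral>\<^sup>+U. ennreal (flip_mass (glue T U)) \<partial>SM2) \<le> ennreal (17 / 96 * \<rho>)"
  proof (cases "missed T")
    case True
    then show ?thesis by (simp add: flip_mass_def missed_glue)
  next
    case False
    define I where "I = {n1..<n1 + n2 (num_candidates T)}"
    define k where "k = real (num_candidates T)"
    define n where "n = real (n2 (num_candidates T))"
    note I = second_range[of T, folded I_def]
    have k: "0 < k" using num_candidates_pos by (simp add: k_def)
    have n: "0 < n" using n2_pos by (simp add: n_def)
    have cI: "card I = n" by (simp add: I_def n_def)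
    interpret P2: prob_space SM2
      by (intro prob_space_PiM prob_space_axioms)
    have "card heavy \<le> num_candidates T"
      unfolding num_candidates_def using False by (intro card_mono) (auto simp: missed_def)
    then have heavy_le_k: "card heavy \<le> k" by (simp add: k_def)
    have [measurable]: "(\<lambda>S. emp_freq S I x) \<in> borel_measurable SM2" if "x \<in> heavy" for x
      using heavy_in_space[OF that] I by (intro emp_freq_measurable) (auto simp: I_def)
    define c where "c = 3 * k / (\<rho> * \<epsilon>\<^sup>2)"
    have c: "0 \<le> c" using k rho by (simp add: c_def)
    txt \<open>The weight \<open>c\<close> is chosen so that the two terms contribute comparable multiples of \<open>\<rho>\<close>.\<close>
    have amgm: "\<bar>d\<bar> / \<epsilon> \<le> c * d\<^sup>2 + \<rho> / (12 * k)" for d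
    proof -
      have "c * d\<^sup>2 + \<rho> / (12 * k) - \<bar>d\<bar> / \<epsilon> = 3 * k / \<rho> * (\<bar>d\<bar> / \<epsilon> - \<rho> / (6 * k))\<^sup>2"
        using k rho eps by (simp add: c_def field_simps power2_eq_square)
      also have "\<dots> \<ge> 0" using k rho by simp
      finally show ?thesis by simp
    qed
    have "(\<integral>\<^sup>+U. ennreal (flip_mass (glue T U)) \<partial>SM2)
        \<le> (\<integral>\<^sup>+U. (\<Sum>x\<in>heavy. ennreal c * ennreal ((emp_freq U I x - mass x)\<^sup>2) + ennreal (\<rho> / (12 * k))) \<partial>SM2)"
    proof (rule nn_integral_mono)
      fix U
      have "flip_mass (glue T U) = (\<Sum>x\<in>heavy. \<bar>emp_freq U I x - mass x\<bar> / \<epsilon>)"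
        using False by (simp add: flip_mass_def missed_glue freq_glue I_def)
      also have "\<dots> \<le> (\<Sum>x\<in>heavy. c * (emp_freq U I x - mass x)\<^sup>2 + \<rho> / (12 * k))"
        by (intro sum_mono amgm)
      finally have "ennreal (flip_mass (glue T U))
          \<le> ennreal (\<Sum>x\<in>heavy. c * (emp_freq U I x - mass x)\<^sup>2 + \<rho> / (12 * k))"
        by (rule ennreal_leI)
      also have "\<dots> = (\<Sum>x\<in>heavy. ennreal (c * (emp_freq U I x - mass x)\<^sup>2 + \<rho> / (12 * k)))"
        using c k rho by (intro sum_ennreal[symmetric]) auto
      also have "\<dots> = (\<Sum>x\<in>heavy. ennreal c * ennreal ((emp_freq U I x - mass x)\<^sup>2) + ennreal (\<rho> / (12 * k)))"
        using c k rho by (intro sum.cong refl) (simp add: ennreal_plus ennreal_mult)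
      finally show "ennreal (flip_mass (glue T U)) \<le> \<dots>" .
    qed
    also have "\<dots> = (\<Sum>x\<in>heavy. ennreal c * (\<integral>\<^sup>+U. ennreal ((emp_freq U I x - mass x)\<^sup>2) \<partial>SM2) + ennreal (\<rho> / (12 * k)))"
      by (subst nn_integral_sum)
         (auto simp: nn_integral_add nn_integral_cmult P2.emeasure_space_1 intro!: sum.cong)
    also have "\<dots> \<le> (\<Sum>x\<in>heavy. ennreal c * ennreal (mass x / n) + ennreal (\<rho> / (12 * k)))"
      unfolding cI[symmetric] using I heavy_in_space
      by (intro sum_mono add_mono mult_left_mono order_refl emp_freq_second_moment) (auto simp: I_def)
    also have "\<dots> = (\<Sum>x\<in>heavy. ennreal (c * (mass x / n) + \<rho> / (12 * k)))"
      using c k n rho by (intro sum.cong refl) (simp add: ennreal_plus ennreal_mult[symmetric])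
    also have "\<dots> = ennreal (\<Sum>x\<in>heavy. c * (mass x / n) + \<rho> / (12 * k))"
      using c k n rho by (intro sum_ennreal) auto
    also have "\<dots> \<le> ennreal (17 / 96 * \<rho>)"
    proof (rule ennreal_leI)
      have "(\<Sum>x\<in>heavy. c * (mass x / n) + \<rho> / (12 * k)) = c * (sum mass heavy / n) + card heavy * (\<rho> / (12 * k))"
        by (simp add: sum.distrib sum_distrib_left sum_divide_distrib)
      also have "\<dots> \<le> c * (1 / n) + k * (\<rho> / (12 * k))"
        using c n k rho heavy_le_k finite_heavy
        by (intro add_mono mult_left_mono mult_right_mono divide_right_mono sum_mass_le_1) auto
      also have "c * (1 / n) \<le> 3 / 32 * \<rho>"
      proof -
        \<comment> \<open>The summand \<open>k\<close> of the second sample size suffices here; it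
          cancels the factor \<open>k\<close> in \<open>c\<close>.\<close>
        have "32 * k / (\<rho>\<^sup>2 * \<epsilon>\<^sup>2) \<le> 32 * (ln (2 / m) + k + 1) / (\<rho>\<^sup>2 * \<epsilon>\<^sup>2)"
          using m by (intro divide_right_mono mult_left_mono) auto
        also have "\<dots> \<le> n" unfolding n_def k_def by (rule n2_ge)
        finally have "32 * k \<le> n * (\<rho>\<^sup>2 * \<epsilon>\<^sup>2)"
          using rho eps by (simp add: field_simps)
        then show ?thesis
          using rho eps n by (simp add: c_def field_simps power2_eq_square)
      qed
      also have "k * (\<rho> / (12 * k)) = \<rho> / 12" using k by simp
      finally show "(\<Sum>x\<in>heavy. c * (mass x / n) + \<rho> / (12 * k)) \<le> 17 / 96 * \<rho>" by simp
    qed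
    finally show ?thesis .
  qed
qed measurable

section \<open>Effect of the random threshold\<close>

abbreviation "thresholds \<equiv> {v - \<epsilon> / 2 .. v + \<epsilon> / 2}"

lemma space_R [simp]: "space R = UNIV" and sets_R [measurable_cong, simp]: "sets R = sets borel"
  by (simp_all add: hh_threshold_def)

lemma emeasure_lborel_thresholds: "emeasure lborel thresholds = ennreal \<epsilon>"
  using eps by simp

lemma prob_space_R: "prob_space R"
  unfolding hh_threshold_def using eps
  by (intro prob_space_uniform_measure) (simp_all only: emeasure_lborel_thresholds, auto)

lemma AE_R: "AE r in R. r \<in> thresholds"
  unfolding hh_threshold_def by (intro AE_uniform_measureI) auto

text \<open>The thresholds that separate \<open>a\<close> from \<open>b\<close> form an interval of
  length \<open>\<bar>a - b\<bar>\<close>, and the threshold has density at most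
  \<open>1 / \<epsilon>\<close>.\<close>

lemma emeasure_R_flip: "emeasure R {r. (r \<le> a) \<noteq> (r \<le> b)} \<le> ennreal (\<bar>a - b\<bar> / \<epsilon>)"
proof -
  have eq: "{r. (r \<le> a) \<noteq> (r \<le> b)} = {min a b<..max a b}" by auto
  have "emeasure R {min a b<..max a b} = emeasure lborel (thresholds \<inter> {min a b<..max a b}) / ennreal \<epsilon>"
    unfolding hh_threshold_def by (subst emeasure_uniform_measure) (auto simp only: emeasure_lborel_thresholds sets_lborel, auto)
  also have "\<dots> \<le> emeasure lborel {min a b<..max a b} / ennreal \<epsilon>"
    by (intro divide_right_mono_ennreal emeasure_mono) auto
  also have "\<dots> = ennreal (max a b - min a b) / ennreal \<epsilon>" by simp
  also have "\<dots> = ennreal (\<bar>a - b\<bar> / \<epsilon>)"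
    using eps by (subst divide_ennreal) (auto simp: max_def min_def abs_if)
  finally show ?thesis by (simp only: eq)
qed

text \<open>Every heavy element is a candidate and passes the same comparison on both sides. A
  candidate outside \<open>heavy\<close> has frequency below \<open>v - \<epsilon> / 2\<close>,
  hence below the threshold.\<close>

lemma L_eq_ideal:
  assumes "\<not> missed S" "\<not> deviates S" "r \<in> thresholds" "\<And>x. x \<in> heavy \<Longrightarrow> (r \<le> freq S x) = (r \<le> mass x)"
  shows "L S r = ideal r"
proof (rule set_eqI)
  fix x
  show "x \<in> L S r \<longleftrightarrow> x \<in> ideal r"
  proof (cases "x \<in> heavy")
    case True
    then show ?thesis using assms by (auto simp: in_L_iff ideal_def missed_def)
  next
    case False
    have "x \<notin> L S r"
    proof
      assume "x \<in> L S r"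
      then obtain i where i: "i < n1" "x = S i" "r \<le> freq S x" by (auto simp: in_L_iff)
      then have "\<bar>freq S x - mass x\<bar> < \<epsilon> / 2"
        using assms(2) by (auto simp: deviates_def not_le)
      moreover have "mass x < v - \<epsilon>" using False by (simp add: heavy_def)
      ultimately show False using i assms(3) unfolding atLeastAtMost_iff abs_less_iff by argo
    qed
    then show ?thesis using False by (simp add: ideal_def)
  qed
qed

text \<open>A bad sample is charged the trivial bound 1. On a good one, a disagreement requires a
  threshold between the mass and the frequency of some heavy element.\<close>

lemma fail_given_sample:
  "emeasure R {r. L S r \<noteq> ideal r}
     \<le> indicator {S. missed S} S + indicator {S. deviates S} S + ennreal (flip_mass S)"
proof -
  interpret R: prob_space R by (rule prob_space_R)
  show ?thesis
  proof (cases "missed S \<or> deviates S")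
    case True
    have "emeasure R {r. L S r \<noteq> ideal r} \<le> 1" by (rule R.measure_le_1)
    also have "1 \<le> (indicator {S. missed S} S + indicator {S. deviates S} S :: ennreal)"
      using True by (auto simp: indicator_def)
    also have "\<dots> \<le> \<dots> + ennreal (flip_mass S)" by simp
    finally show ?thesis .
  next
    case False
    have m: "{r. (r \<le> freq S x) \<noteq> (r \<le> mass x)} \<in> sets R" for x
      by simp
    have "emeasure R {r. L S r \<noteq> ideal r} \<le> emeasure R (\<Union>x\<in>heavy. {r. (r \<le> freq S x) \<noteq> (r \<le> mass x)})"
    \<comment> \<open>The inclusion holds only for thresholds in the prescribed range, which is an
      almost sure event.\<close>
    proof (rule emeasure_mono_AE)
      show "AE r in R. r \<in> {r. L S r \<noteq> ideal r} \<longrightarrow> r \<in> (\<Union>x\<in>heavy. {r. (r \<le> freq S x) \<noteq> (r \<le> mass x)})"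
        using AE_R
      proof eventually_elim
        case (elim r)
        then show ?case using L_eq_ideal[of S r] False by blast
      qed
      show "(\<Union>x\<in>heavy. {r. (r \<le> freq S x) \<noteq> (r \<le> mass x)}) \<in> sets R"
        using finite_heavy m by (intro sets.finite_UN) auto
    qed
    also have "\<dots> \<le> (\<Sum>x\<in>heavy. emeasure R {r. (r \<le> freq S x) \<noteq> (r \<le> mass x)})"
      using finite_heavy m by (intro emeasure_subadditive_finite) auto
    also have "\<dots> \<le> (\<Sum>x\<in>heavy. ennreal (\<bar>freq S x - mass x\<bar> / \<epsilon>))"
      by (intro sum_mono emeasure_R_flip)
    also have "\<dots> = ennreal (flip_mass S)"
      using False eps by (subst sum_ennreal) (auto simp: flip_mass_def)
    also have "\<dots> \<le> indicator {S. missed S} S + indicator {S. deviates S} S + ennreal (flip_mass S)" by simp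
    finally show ?thesis .
  qed
qed

text \<open>Since \<open>m\<close> is at most \<open>\<rho>\<close>, the three contributions fit
  because 7/25 + 1/40 + 17/96 is below 1/2.\<close>

lemma fail_bound: "(\<integral>\<^sup>+S. emeasure R {r. L S r \<noteq> ideal r} \<partial>SM) \<le> ennreal (\<rho> / 2)"
proof -
  have "(\<integral>\<^sup>+S. emeasure R {r. L S r \<noteq> ideal r} \<partial>SM)
      \<le> (\<integral>\<^sup>+S. indicator {S \<in> space SM. missed S} S + indicator {S \<in> space SM. deviates S} S
             + ennreal (flip_mass S) \<partial>SM)"
  proof (rule nn_integral_mono)
    fix S assume "S \<in> space SM"
    then show "emeasure R {r. L S r \<noteq> ideal r} \<le> indicator {S \<in> space SM. missed S} S
         + indicator {S \<in> space SM. deviates S} S + ennreal (flip_mass S)"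
      using fail_given_sample[of S] by (simp add: indicator_def)
  qed
  also have "\<dots> = emeasure SM {S \<in> space SM. missed S} + emeasure SM {S \<in> space SM. deviates S}
      + (\<integral>\<^sup>+S. ennreal (flip_mass S) \<partial>SM)"
    by (simp add: nn_integral_add)
  also have "\<dots> \<le> ennreal (7 / 25 * m) + ennreal (m / 40) + ennreal (17 / 96 * \<rho>)"
    by (intro add_mono missed_bound deviates_bound flip_mass_bound)
  also have "\<dots> = ennreal (7 / 25 * m + m / 40 + 17 / 96 * \<rho>)"
    using m rho by (subst ennreal_plus[symmetric], simp, simp)+ (rule refl)
  also have "\<dots> \<le> ennreal (\<rho> / 2)"
    using rho min.cobounded2[of \<delta> \<rho>] by (intro ennreal_leI) linarith
  finally show ?thesis .
qed

section \<open>Measurability of agreement and accuracy\<close>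

lemma measurable_coordinate:
  "i \<in> {..<n1} \<Longrightarrow> (\<lambda>S. S i) \<in> SM \<rightarrow>\<^sub>M M"
  using n1_le by (intro measurable_component_singleton) auto

text \<open>The sample is an arbitrary measurable map \<open>s\<close> so that the rules apply to
  one run as well as to either sample of a pair of runs.\<close>

lemma
  assumes s: "s \<in> N' \<rightarrow>\<^sub>M SM" and i: "i \<in> {..<n1}"
  shows measurable_compose_coordinate: "(\<lambda>\<omega>. s \<omega> i) \<in> N' \<rightarrow>\<^sub>M M"
    and pred_le_freq: "r \<in> borel_measurable N' \<Longrightarrow> Measurable.pred N' (\<lambda>\<omega>. r \<omega> \<le> freq (s \<omega>) (s \<omega> i))"
    and pred_coordinate_eq: "x \<in> space M \<Longrightarrow> Measurable.pred N' (\<lambda>\<omega>. x = s \<omega> i)"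
    and pred_mass_less: "Measurable.pred N' (\<lambda>\<omega>. mass (s \<omega> i) < c)"
proof -
  show c [measurable]: "(\<lambda>\<omega>. s \<omega> i) \<in> N' \<rightarrow>\<^sub>M M"
    using measurable_compose[OF s measurable_coordinate[OF i]] .
  show "Measurable.pred N' (\<lambda>\<omega>. x = s \<omega> i)" if "x \<in> space M"
    using that by measurable
  have "(\<lambda>\<omega>. freq (s \<omega>) (s \<omega> i)) \<in> borel_measurable N'"
    using measurable_compose[OF s measurable_freq_coordinate] i by simp
  then show "Measurable.pred N' (\<lambda>\<omega>. r \<omega> \<le> freq (s \<omega>) (s \<omega> i))" if "r \<in> borel_measurable N'"
    using that by measurable
  have "(\<lambda>\<omega>. mass (s \<omega> i)) \<in> borel_measurable N'"
    using measurable_compose[OF c mass_measurable] .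
  then show "Measurable.pred N' (\<lambda>\<omega>. mass (s \<omega> i) < c)" by measurable
qed

lemmas agreement_measurability_rules = pred_intros_logic(2-4) pred_intros_finite(3,4) finite_heavy finite_lessThan
  pred_le_freq pred_mass_less pred_coordinate_eq pred_eq measurable_compose_coordinate

text \<open>Equality of the two sets is rewritten with quantifiers over sample positions and over
  \<open>heavy\<close>, both finite, so no sigma-algebra on sets of points is required.\<close>

lemma pred_L_eq_ideal:
  assumes s: "s \<in> N' \<rightarrow>\<^sub>M SM" and r: "r \<in> borel_measurable N'"
  shows "Measurable.pred N' (\<lambda>\<omega>. L (s \<omega>) (r \<omega>) = ideal (r \<omega>))"
proof -
  have eq: "L S r = ideal r \<longleftrightarrow>
      (\<forall>i\<in>{..<n1}. r \<le> freq S (S i) \<longrightarrow> (\<exists>x\<in>heavy. x = S i \<and> r \<le> mass x)) \<and>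
      (\<forall>x\<in>heavy. r \<le> mass x \<longrightarrow> (\<exists>i\<in>{..<n1}. x = S i \<and> r \<le> freq S (S i)))" for S r
    by (auto simp: set_eq_iff in_L_iff ideal_def)
  have "Measurable.pred N' (\<lambda>\<omega>. r \<omega> \<le> c)" for c
    using r by measurable
  then show ?thesis
    unfolding eq by (intro agreement_measurability_rules s r heavy_in_space)
qed

lemma L_image: "L S r = S ` {i \<in> {..<n1}. r \<le> freq S (S i)}"
  by (auto simp: in_L_iff)

lemma pred_L_eq_L:
  assumes s: "s \<in> N' \<rightarrow>\<^sub>M SM" "s' \<in> N' \<rightarrow>\<^sub>M SM" and r: "r \<in> borel_measurable N'"
  shows "Measurable.pred N' (\<lambda>\<omega>. L (s \<omega>) (r \<omega>) = L (s' \<omega>) (r \<omega>))"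
proof -
  have eq: "L S r = L S' r \<longleftrightarrow>
      (\<forall>i\<in>{..<n1}. r \<le> freq S (S i) \<longrightarrow> (\<exists>j\<in>{..<n1}. S i = S' j \<and> r \<le> freq S' (S' j))) \<and>
      (\<forall>i\<in>{..<n1}. r \<le> freq S' (S' i) \<longrightarrow> (\<exists>j\<in>{..<n1}. S' i = S j \<and> r \<le> freq S (S j)))" for S S' r
    unfolding L_image set_eq_subset image_subset_iff by (simp add: image_iff Ball_def Bex_def conj_ac imp_conjL)
  show ?thesis
    unfolding eq by (intro agreement_measurability_rules s r)
qed

definition accurate :: "(nat \<Rightarrow> 'a) \<Rightarrow> real \<Rightarrow> bool" where
  "accurate S r \<longleftrightarrow> (\<forall>x\<in>space M. (mass x < v - \<epsilon> \<longrightarrow> x \<notin> L S r) \<and> (mass x > v + \<epsilon> \<longrightarrow> x \<in> L S r))"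

text \<open>The quantifier over the whole space becomes finite: the first clause can only fail at a
  sampled point, and the second one concerns only the finitely many points of mass above
  \<open>v + \<epsilon>\<close>.\<close>

lemma pred_accurate:
  assumes s: "s \<in> N' \<rightarrow>\<^sub>M SM" and r: "r \<in> borel_measurable N'"
  shows "Measurable.pred N' (\<lambda>\<omega>. accurate (s \<omega>) (r \<omega>))"
proof -
  define very_heavy where "very_heavy = {x \<in> heavy. v + \<epsilon> < mass x}"
  have fin: "finite very_heavy" using finite_heavy by (simp add: very_heavy_def)
  have very_heavy: "x \<in> very_heavy \<longleftrightarrow> x \<in> space M \<and> v + \<epsilon> < mass x" for x
    using eps heavy_in_space[of x] by (auto simp: very_heavy_def heavy_def)
  have eq: "accurate S r \<longleftrightarrow>
      (\<forall>i\<in>{..<n1}. mass (S i) < v - \<epsilon> \<longrightarrow> \<not> r \<le> freq S (S i)) \<and>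
      (\<forall>x\<in>very_heavy. \<exists>i\<in>{..<n1}. x = S i \<and> r \<le> freq S (S i))" if "S \<in> space SM" for S r
  proof -
    have "S i \<in> space M" if "i < n1" for i
      using \<open>S \<in> space SM\<close> that n1_le by (intro PiE_mem[of S "{..<N}"]) (auto simp: space_PiM)
    then show ?thesis
      unfolding accurate_def in_L_iff image_iff Ball_def Bex_def very_heavy lessThan_iff by blast
  qed
  have "x \<in> space M" if "x \<in> very_heavy" for x
    using that by (simp add: very_heavy)
  then have "Measurable.pred N' (\<lambda>\<omega>. (\<forall>i\<in>{..<n1}. mass (s \<omega> i) < v - \<epsilon> \<longrightarrow> \<not> r \<omega> \<le> freq (s \<omega>) (s \<omega> i)) \<and>
      (\<forall>x\<in>very_heavy. \<exists>i\<in>{..<n1}. x = s \<omega> i \<and> r \<omega> \<le> freq (s \<omega>) (s \<omega> i)))"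
    by (intro agreement_measurability_rules s r fin)
  then show ?thesis
    using measurable_space[OF s] by (simp add: eq cong: measurable_cong)
qed

section \<open>Replicability and accuracy of the algorithm\<close>

lemma replicable_bound:
  defines "P \<equiv> SM \<Otimes>\<^sub>M (SM \<Otimes>\<^sub>M R)"
  defines "E \<equiv> {(S, S', r) \<in> space P. L S r \<noteq> L S' r}"
  shows "E \<in> sets P" "measure P E \<le> \<rho>"
proof -
  interpret S: prob_space SM by (rule prob_space_SM)
  interpret R: prob_space R by (rule prob_space_R)
  interpret SR: pair_prob_space SM R ..
  interpret P: pair_prob_space SM "SM \<Otimes>\<^sub>M R" ..
  have "Measurable.pred P (\<lambda>p. \<not> L (fst p) (snd (snd p)) = L (fst (snd p)) (snd (snd p)))"
    unfolding P_def by (intro pred_intros_logic(2) pred_L_eq_L) measurable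
  then show E: "E \<in> sets P"
    by (simp add: pred_def E_def split_beta')
  define B where "B = {p \<in> space (SM \<Otimes>\<^sub>M R). L (fst p) (snd p) \<noteq> ideal (snd p)}"
  have "Measurable.pred (SM \<Otimes>\<^sub>M R) (\<lambda>p. \<not> L (fst p) (snd p) = ideal (snd p))"
    by (intro pred_intros_logic(2) pred_L_eq_ideal) measurable
  then have B: "B \<in> sets (SM \<Otimes>\<^sub>M R)" by (simp add: pred_def B_def)
  have slice: "Pair S -` B = {r. L S r \<noteq> ideal r}" if "S \<in> space SM" for S
    using that by (auto simp: B_def space_pair_measure)
  have "emeasure (SM \<Otimes>\<^sub>M R) B = (\<integral>\<^sup>+S. emeasure R {r. L S r \<noteq> ideal r} \<partial>SM)"
    using B by (subst R.emeasure_pair_measure_alt) (auto simp: slice intro!: nn_integral_cong)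
  then have Ble: "emeasure (SM \<Otimes>\<^sub>M R) B \<le> ennreal (\<rho> / 2)" using fail_bound by simp
  \<comment> \<open>\<open>A1\<close> and \<open>A2\<close> are the events that the first and the
    second run, respectively, differ from \<open>ideal\<close>.\<close>
  define A1 where "A1 = {p \<in> space P. L (fst p) (snd (snd p)) \<noteq> ideal (snd (snd p))}"
  define A2 where "A2 = space SM \<times> B"
  have "Measurable.pred P (\<lambda>p. \<not> L (fst p) (snd (snd p)) = ideal (snd (snd p)))"
    unfolding P_def by (intro pred_intros_logic(2) pred_L_eq_ideal) measurable
  then have A1: "A1 \<in> sets P" by (simp add: pred_def A1_def)
  have A2: "A2 \<in> sets P" using B by (simp add: A2_def P_def)
  \<comment> \<open>Slicing at the first sample leaves the second one unconstrained, so each slice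
    is a cylinder over a set of thresholds.\<close>
  have "emeasure P A1 = (\<integral>\<^sup>+S. emeasure (SM \<Otimes>\<^sub>M R) (space SM \<times> {r. L S r \<noteq> ideal r}) \<partial>SM)"
    using A1 unfolding P_def
    by (subst SR.P.emeasure_pair_measure_alt)
       (auto simp: A1_def P_def space_pair_measure intro!: nn_integral_cong arg_cong[where f = "emeasure _"])
  also have "\<dots> = (\<integral>\<^sup>+S. emeasure R {r. L S r \<noteq> ideal r} \<partial>SM)"
  proof (rule nn_integral_cong)
    fix S assume S: "S \<in> space SM"
    have "{r. L S r \<noteq> ideal r} \<in> sets R"
      using sets_Pair1[OF B, of S] slice[OF S] by simp
    then show "emeasure (SM \<Otimes>\<^sub>M R) (space SM \<times> {r. L S r \<noteq> ideal r}) = emeasure R {r. L S r \<noteq> ideal r}"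
      by (subst R.emeasure_pair_measure_Times) (auto simp: S.emeasure_space_1)
  qed
  finally have le1: "emeasure P A1 \<le> ennreal (\<rho> / 2)" using fail_bound by simp
  have "emeasure P A2 = emeasure (SM \<Otimes>\<^sub>M R) B"
    unfolding A2_def P_def using B
    by (subst SR.P.emeasure_pair_measure_Times) (auto simp: S.emeasure_space_1)
  with Ble have le2: "emeasure P A2 \<le> ennreal (\<rho> / 2)" by simp
  \<comment> \<open>Two runs that both return \<open>ideal\<close> at the shared threshold
    agree.\<close>
  have "emeasure P E \<le> emeasure P (A1 \<union> A2)"
    using A1 A2 by (intro emeasure_mono) (auto simp: E_def A1_def A2_def B_def P_def space_pair_measure)
  also have "\<dots> \<le> emeasure P A1 + emeasure P A2"
    using A1 A2 by (rule emeasure_subadditive)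
  also have "\<dots> \<le> ennreal (\<rho> / 2) + ennreal (\<rho> / 2)"
    by (intro add_mono le1 le2)
  also have "\<dots> = ennreal \<rho>"
    using rho by (simp flip: ennreal_plus)
  finally show "measure P E \<le> \<rho>"
    using rho by (simp add: measure_def enn2real_leI)
qed

text \<open>On a sample that neither misses nor deviates, every threshold in the range gives an
  accurate list: the error \<open>\<epsilon>\<close> splits into \<open>\<epsilon> / 2\<close> for
  the frequency and \<open>\<epsilon> / 2\<close> for the threshold.\<close>

lemma accurate_bound: "\<P>((S, r) in SM \<Otimes>\<^sub>M R. accurate S r) \<ge> 1 - \<delta>"
proof -
  interpret S: prob_space SM by (rule prob_space_SM)
  interpret R: prob_space R by (rule prob_space_R)
  interpret SR: pair_prob_space SM R ..
  define C where "C = {S \<in> space SM. missed S \<or> deviates S}"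
  have C: "C \<in> sets SM" unfolding C_def by measurable
  have "C = {S \<in> space SM. missed S} \<union> {S \<in> space SM. deviates S}" by (auto simp: C_def)
  then have "emeasure SM C \<le> emeasure SM {S \<in> space SM. missed S} + emeasure SM {S \<in> space SM. deviates S}"
    by (simp only:) (intro emeasure_subadditive; measurable)
  also have "\<dots> \<le> ennreal (7 / 25 * m) + ennreal (m / 40)"
    by (intro add_mono missed_bound deviates_bound)
  also have "\<dots> = ennreal (7 / 25 * m + m / 40)"
    using m by (intro ennreal_plus[symmetric]) simp_all
  also have "\<dots> \<le> ennreal \<delta>"
    using del min.cobounded1[of \<delta> \<rho>] by (intro ennreal_leI) linarith
  finally have "S.prob C \<le> \<delta>"
    using del by (simp add: S.emeasure_eq_measure)
  then have "1 - \<delta> \<le> S.prob (space SM - C)"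
    using C by (simp add: S.prob_compl)
  \<comment> \<open>The threshold range has probability 1, and multiplying by it turns the bound on
    samples into one on a rectangle.\<close>
  also have "\<dots> = S.prob (space SM - C) * R.prob thresholds"
    using AE_R by (subst R.prob_eq_1[THEN iffD2]) auto
  also have "\<dots> = measure (SM \<Otimes>\<^sub>M R) ((space SM - C) \<times> thresholds)"
    using C by (simp add: measure_def R.emeasure_pair_measure_Times enn2real_mult)
  also have "\<dots> \<le> measure (SM \<Otimes>\<^sub>M R) {p \<in> space (SM \<Otimes>\<^sub>M R). accurate (fst p) (snd p)}"
  proof (rule SR.finite_measure_mono)
    have "Measurable.pred (SM \<Otimes>\<^sub>M R) (\<lambda>p. accurate (fst p) (snd p))"
      by (intro pred_accurate) measurable
    then show "{p \<in> space (SM \<Otimes>\<^sub>M R). accurate (fst p) (snd p)} \<in> sets (SM \<Otimes>\<^sub>M R)"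
      by (simp add: pred_def)
    have acc: "accurate S r" if S: "S \<in> space SM" "\<not> missed S" "\<not> deviates S" and r: "r \<in> thresholds" for S r
    proof -
      have dev: "\<bar>freq S (S i) - mass (S i)\<bar> < \<epsilon> / 2" if "i < n1" for i
        using S(3) that by (auto simp: deviates_def not_le)
      show ?thesis
        unfolding accurate_def
      proof (intro ballI conjI impI)
        fix x assume x: "mass x < v - \<epsilon>"
        show "x \<notin> L S r"
        proof
          assume "x \<in> L S r"
          then obtain i where i: "i < n1" "x = S i" "r \<le> freq S (S i)" by (auto simp: in_L_iff)
          with dev[of i] x r show False
            unfolding atLeastAtMost_iff abs_less_iff by simp
        qed
      next
        fix x assume x: "v + \<epsilon> < mass x"
        then have "x \<in> heavy" using eps by (simp add: heavy_def)
        then obtain i where i: "i < n1" "x = S i" using S(2) by (auto simp: missed_def)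
        with dev[of i] x r have "r \<le> freq S x"
          unfolding atLeastAtMost_iff abs_less_iff by simp
        with i show "x \<in> L S r" by (auto simp: in_L_iff)
      qed
    qed
    show "(space SM - C) \<times> thresholds \<subseteq> {p \<in> space (SM \<Otimes>\<^sub>M R). accurate (fst p) (snd p)}"
      by (auto simp: C_def space_pair_measure intro!: acc)
  qed
  finally show ?thesis by (simp add: split_beta')
qed

end

section \<open>Sample complexity\<close>

text \<open>The maximum with 1 absorbs the additive constants and the rounding, also where
  \<open>l\<close> is close to 0.\<close>

lemma hh_sample_size_le:
  assumes par: "hh_params \<epsilon> \<delta> \<rho> v"
  defines "l \<equiv> log 2 (1 / (min \<delta> \<rho> * (v - \<epsilon>)))"
  shows "0 \<le> l" "real (hh_sample_size \<epsilon> \<delta> \<rho> v) \<le> 200 * (max 1 l / ((v - \<epsilon>) * \<rho>\<^sup>2 * \<epsilon>\<^sup>2))"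
proof -
  define q where "q = v - \<epsilon>"
  define m where "m = min \<delta> \<rho>"
  define w where "w = \<rho>\<^sup>2 * \<epsilon>\<^sup>2"
  define t where "t = max 1 l"
  define N1 where "N1 = hh_n1 \<epsilon> \<delta> \<rho> v"
  have q: "0 < q" "q < 1" and m: "0 < m" "m < 1" and e: "0 < \<epsilon>" "\<epsilon> < 1" and r: "0 < \<rho>" "\<rho> < 1"
    using par by (auto simp: hh_params_def q_def m_def)
  have w: "0 < w" "w \<le> 1"
    using e r by (auto simp: w_def intro!: mult_le_one power_le_one)
  have mq: "0 < m * q" "m * q \<le> 1"
    using q m by (auto intro!: mult_le_one)
  have l: "l = log 2 (1 / (m * q))" by (simp add: l_def m_def q_def)
  show l0: "0 \<le> l" using mq by (simp add: l)
  have t: "1 \<le> t" "l \<le> t" by (simp_all add: t_def)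
  have "log 2 (2 / (m * q)) = 1 + l"
    using q m log_mult[of 2 2 "1 / (m * q)"] by (simp add: l)
  moreover have "0 \<le> (1 + l) / q" using l0 q by simp
  ultimately have "real N1 \<le> (1 + l) / q + 1"
    using of_nat_ceiling[of "(1 + l) / q"] ceiling_correct[of "(1 + l) / q"]
    by (simp add: N1_def hh_n1_def q_def m_def)
  also have "\<dots> \<le> 2 * t / q + t / q"
    using t q by (intro add_mono divide_right_mono) (simp_all add: field_simps)
  finally have N1: "real N1 \<le> 3 * t / q" by simp
  \<comment> \<open>Passing to base 2 and inserting the factor \<open>q\<close> below 1 compares the
    logarithm of the second sample size with that of the first.\<close>
  have "ln (2 / m) \<le> log 2 (2 / m)"
  proof -
    have "ln (2 / m) * ln 2 \<le> ln (2 / m) * 1"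
      using m ln_2_less_1 by (intro mult_left_mono) auto
    then show ?thesis by (simp add: log_def field_simps)
  qed
  also have "\<dots> \<le> log 2 (2 / (m * q))"
    using m q mq by (simp add: field_simps)
  also have "\<dots> = 1 + l" by fact
  finally have lnm: "ln (2 / m) \<le> 2 * t" using t by simp
  have tq: "t \<le> t / q" using t q by (simp add: field_simps)
  have ln0: "0 \<le> ln (2 / m)" using m by simp
  define a where "a = 32 * (ln (2 / m) + real N1 + 1) / w"
  have a0: "0 \<le> a" using ln0 w by (simp add: a_def)
  have "real (hh_n2 \<epsilon> \<delta> \<rho> N1) \<le> a + 1"
    using a0 ceiling_correct[of a] by (simp add: hh_n2_def a_def m_def w_def)
  \<comment> \<open>The factor 6 is 2 + 3 + 1: the logarithm, the first sample size and the constant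
    1.\<close>
  also have "a \<le> 32 * (6 * (t / q)) / w"
    unfolding a_def using lnm N1 tq t w by (intro divide_right_mono mult_left_mono) auto
  also have "1 \<le> t / q / w"
  proof -
    have "1 * w \<le> t / q" using w tq t by linarith
    then show ?thesis using w by (subst pos_le_divide_eq)
  qed
  finally have N2: "real (hh_n2 \<epsilon> \<delta> \<rho> N1) \<le> 193 * (t / q / w)" by simp
  have "t / q \<le> t / q / w"
    using w t q by (simp add: pos_le_divide_eq mult_left_le)
  with N1 N2 have "real (hh_sample_size \<epsilon> \<delta> \<rho> v) \<le> 196 * (t / q / w)"
    by (simp add: hh_sample_size_def N1_def)
  also have "\<dots> \<le> 200 * (t / q / w)"
    using t q w by (intro mult_right_mono) auto
  finally show "real (hh_sample_size \<epsilon> \<delta> \<rho> v) \<le> 200 * (max 1 l / ((v - \<epsilon>) * \<rho>\<^sup>2 * \<epsilon>\<^sup>2))"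
    by (simp add: t_def q_def w_def mult.assoc)
qed

text \<open>The principal filter expresses a bound that is uniform over a parameter set, with no
  limit involved.\<close>

lemma bigo_principalI:
  assumes "\<And>x. x \<in> A \<Longrightarrow> \<bar>f x\<bar> \<le> C * \<bar>g x :: real\<bar>"
  shows "f \<in> O[principal A](g)"
  using assms by (intro bigoI[where c = C]) (auto simp: eventually_principal)

text \<open>The plain logarithm tends to 0 as \<open>min \<delta> \<rho> * (v - \<epsilon>)\<close>
  tends to 1, while the additive constants in the sample sizes remain. Hence that form of the bound
  keeps the product below a fixed \<open>c < 1\<close>, and the form with \<open>max 1\<close>
  covers all parameters.\<close>

theorem lemma5:
  fixes X :: "'a measure"
  assumes diagonal: "{(x, y) \<in> space (X \<Otimes>\<^sub>M X). x = y} \<in> sets (X \<Otimes>\<^sub>M X)"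
  shows "(\<forall>\<epsilon> \<delta> \<rho> v. hh_params \<epsilon> \<delta> \<rho> v \<longrightarrow>
           replicable \<rho> (hh_sample_size \<epsilon> \<delta> \<rho> v) X (hh_threshold \<epsilon> v) (heavy_hitters \<epsilon> \<delta> \<rho> v) \<and>
           (\<forall>D \<in> space (prob_algebra X).
              \<P>((S, v') in PiM {..<hh_sample_size \<epsilon> \<delta> \<rho> v} (\<lambda>_. D) \<Otimes>\<^sub>M hh_threshold \<epsilon> v.
                 \<forall>x \<in> space X.
                   (measure D {x} < v - \<epsilon> \<longrightarrow> x \<notin> heavy_hitters \<epsilon> \<delta> \<rho> v S v') \<and>
                   (measure D {x} > v + \<epsilon> \<longrightarrow> x \<in> heavy_hitters \<epsilon> \<delta> \<rho> v S v')) \<ge> 1 - \<delta>)) \<and>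
         (\<forall>c < 1.
           (\<lambda>(\<epsilon>, \<delta>, \<rho>, v). real (hh_sample_size \<epsilon> \<delta> \<rho> v))
             \<in> O[principal {(\<epsilon>, \<delta>, \<rho>, v). hh_params \<epsilon> \<delta> \<rho> v \<and> min \<delta> \<rho> * (v - \<epsilon>) \<le> c}](\<lambda>(\<epsilon>, \<delta>, \<rho>, v).
                   log 2 (1 / (min \<delta> \<rho> * (v - \<epsilon>))) / ((v - \<epsilon>) * \<rho>\<^sup>2 * \<epsilon>\<^sup>2))) \<and>
         (\<lambda>(\<epsilon>, \<delta>, \<rho>, v). real (hh_sample_size \<epsilon> \<delta> \<rho> v))
           \<in> O[principal {(\<epsilon>, \<delta>, \<rho>, v). hh_params \<epsilon> \<delta> \<rho> v}](\<lambda>(\<epsilon>, \<delta>, \<rho>, v).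
                 max 1 (log 2 (1 / (min \<delta> \<rho> * (v - \<epsilon>)))) / ((v - \<epsilon>) * \<rho>\<^sup>2 * \<epsilon>\<^sup>2))"
proof (intro conjI allI impI ballI)
  fix \<epsilon> \<delta> \<rho> v :: real
  assume par: "hh_params \<epsilon> \<delta> \<rho> v"
  have run: "heavy_hitters_run D \<epsilon> \<delta> \<rho> v" "space D = space X" if "D \<in> space (prob_algebra X)" for D
  proof -
    from that have D: "prob_space D" and sets: "sets D = sets X"
      by (auto simp: space_prob_algebra)
    have *: "sets (D \<Otimes>\<^sub>M D) = sets (X \<Otimes>\<^sub>M X)"
      using sets by (intro sets_pair_measure_cong)
    interpret prob_space D by fact
    show "space D = space X" using sets by (rule sets_eq_imp_space_eq)
    show "heavy_hitters_run D \<epsilon> \<delta> \<rho> v"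
      using diagonal par by unfold_locales (simp_all add: * sets_eq_imp_space_eq[OF *])
  qed
  show "replicable \<rho> (hh_sample_size \<epsilon> \<delta> \<rho> v) X (hh_threshold \<epsilon> v) (heavy_hitters \<epsilon> \<delta> \<rho> v)"
    unfolding replicable_def Let_def
  proof (intro conjI ballI)
    have "0 < \<epsilon>" using par by (simp add: hh_params_def)
    then show "prob_space (hh_threshold \<epsilon> v)"
      unfolding hh_threshold_def by (intro prob_space_uniform_measure) auto
  qed (use heavy_hitters_run.replicable_bound[OF run(1)] in auto)
  fix D assume D: "D \<in> space (prob_algebra X)"
  interpret heavy_hitters_run D \<epsilon> \<delta> \<rho> v by (rule run(1)[OF D])
  show "\<P>((S, v') in PiM {..<hh_sample_size \<epsilon> \<delta> \<rho> v} (\<lambda>_. D) \<Otimes>\<^sub>M hh_threshold \<epsilon> v.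
           \<forall>x \<in> space X.
             (measure D {x} < v - \<epsilon> \<longrightarrow> x \<notin> heavy_hitters \<epsilon> \<delta> \<rho> v S v') \<and>
             (measure D {x} > v + \<epsilon> \<longrightarrow> x \<in> heavy_hitters \<epsilon> \<delta> \<rho> v S v')) \<ge> 1 - \<delta>"
    using accurate_bound unfolding accurate_def run(2)[OF D] .
next
  fix c :: real assume c: "c < 1"
  show "(\<lambda>(\<epsilon>, \<delta>, \<rho>, v). real (hh_sample_size \<epsilon> \<delta> \<rho> v))
             \<in> O[principal {(\<epsilon>, \<delta>, \<rho>, v). hh_params \<epsilon> \<delta> \<rho> v \<and> min \<delta> \<rho> * (v - \<epsilon>) \<le> c}](\<lambda>(\<epsilon>, \<delta>, \<rho>, v).
                   log 2 (1 / (min \<delta> \<rho> * (v - \<epsilon>))) / ((v - \<epsilon>) * \<rho>\<^sup>2 * \<epsilon>\<^sup>2))"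
  \<comment> \<open>Here \<open>l\<close> is at least \<open>log 2 (1 / c)\<close>, so the constant
    1 in \<open>max 1 l\<close> is at most \<open>l / log 2 (1 / c)\<close>.\<close>
  proof (rule bigo_principalI[where C = "200 * max 1 (1 / log 2 (1 / c))"], clarify)
    fix \<epsilon> \<delta> \<rho> v :: real
    assume par: "hh_params \<epsilon> \<delta> \<rho> v" and le: "min \<delta> \<rho> * (v - \<epsilon>) \<le> c"
    define l where "l = log 2 (1 / (min \<delta> \<rho> * (v - \<epsilon>)))"
    define d where "d = (v - \<epsilon>) * \<rho>\<^sup>2 * \<epsilon>\<^sup>2"
    note size = hh_sample_size_le[OF par, folded l_def d_def]
    have mq: "0 < min \<delta> \<rho> * (v - \<epsilon>)" and d: "0 < d"
      using par by (auto simp: hh_params_def d_def)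
    \<comment> \<open>Positivity of \<open>c\<close> follows from the existence of a parameter
      tuple; for other \<open>c\<close> the domain is empty.\<close>
    have c0: "0 < c" using mq le by linarith
    have lc: "0 < log 2 (1 / c)" using c c0 by simp
    have "log 2 (1 / c) \<le> l"
      unfolding l_def using mq le c0 by (simp add: field_simps)
    then have "1 \<le> 1 / log 2 (1 / c) * l" using lc by (simp add: field_simps)
    also have "\<dots> \<le> max 1 (1 / log 2 (1 / c)) * l" using size(1) by (intro mult_right_mono) auto
    finally have "max 1 l \<le> max 1 (1 / log 2 (1 / c)) * l"
      using size(1) mult_right_mono[of 1 "max 1 (1 / log 2 (1 / c))" l] by simp
    then have "200 * (max 1 l / d) \<le> 200 * (max 1 (1 / log 2 (1 / c)) * l / d)"
      using d by (intro mult_left_mono divide_right_mono) auto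
    with size d show "\<bar>real (hh_sample_size \<epsilon> \<delta> \<rho> v)\<bar>
        \<le> 200 * max 1 (1 / log 2 (1 / c)) * \<bar>log 2 (1 / (min \<delta> \<rho> * (v - \<epsilon>))) / ((v - \<epsilon>) * \<rho>\<^sup>2 * \<epsilon>\<^sup>2)\<bar>"
      unfolding l_def[symmetric] d_def[symmetric] by simp
  qed
next
  show "(\<lambda>(\<epsilon>, \<delta>, \<rho>, v). real (hh_sample_size \<epsilon> \<delta> \<rho> v))
           \<in> O[principal {(\<epsilon>, \<delta>, \<rho>, v). hh_params \<epsilon> \<delta> \<rho> v}](\<lambda>(\<epsilon>, \<delta>, \<rho>, v).
                 max 1 (log 2 (1 / (min \<delta> \<rho> * (v - \<epsilon>)))) / ((v - \<epsilon>) * \<rho>\<^sup>2 * \<epsilon>\<^sup>2))"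
  proof (rule bigo_principalI[where C = 200], clarify)
    fix \<epsilon> \<delta> \<rho> v :: real
    assume par: "hh_params \<epsilon> \<delta> \<rho> v"
    have "0 < (v - \<epsilon>) * \<rho>\<^sup>2 * \<epsilon>\<^sup>2"
      using par by (auto simp: hh_params_def)
    then have eq: "\<bar>max 1 (log 2 (1 / (min \<delta> \<rho> * (v - \<epsilon>)))) / ((v - \<epsilon>) * \<rho>\<^sup>2 * \<epsilon>\<^sup>2)\<bar>
        = max 1 (log 2 (1 / (min \<delta> \<rho> * (v - \<epsilon>)))) / ((v - \<epsilon>) * \<rho>\<^sup>2 * \<epsilon>\<^sup>2)"
      by (intro abs_of_nonneg divide_nonneg_pos) auto
    show "\<bar>real (hh_sample_size \<epsilon> \<delta> \<rho> v)\<bar>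
        \<le> 200 * \<bar>max 1 (log 2 (1 / (min \<delta> \<rho> * (v - \<epsilon>)))) / ((v - \<epsilon>) * \<rho>\<^sup>2 * \<epsilon>\<^sup>2)\<bar>"
      using hh_sample_size_le(2)[OF par] by (simp only: eq abs_of_nat)
  qed
qed

end
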